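(* Let $x(t+1)=Ax(t)+\sum_{i=1}^mB_iu_i(t)$, $y_i(t)=C_ix(t)$ be an $n$-dimensional, jointly controllable and jointly observable $m$-channel discrete-time linear system whose neighbor graph is weakly connected, with time-invariant integer transmission delays $d_{ij}\ge0$ from agent $i$ to each follower $j$ of $i$ ($d_{ii}=0$), and let $d_i=\max_{j\in\mathcal{F}_i}d_{ij}$. Let nonnegative integers $n_1,\dots,n_m$ be given, $N_z=\sum_k(d_k+1)n_k$, $\hat n=n+N_z$. For $0\le\delta\le d_i$ let $H_{i\delta}$ be the $N_z\times n_i$ block column matrix, partitioned into blocks of sizes $(d_1+1)n_1,\dots,(d_m+1)n_m$, whose $k$th block is zero for $k\neq i$ and whose $i$th block is $\mathrm{column}\{\mathbf{0}_{\delta n_i\times n_i},I_{n_i},\mathbf{0}_{(d_i-\delta)n_i\times n_i}\}$. Define the extended system with state holding $\{\hat A,\hat B_i,\hat C_i;m\}$ by $$\hat A=\mathrm{blockdiag}\Big\{A,\ \begin{bmatrix}0&\mathbf{0}_{n_1}\\ I_{d_1n_1}&0\end{bmatrix},\dots,\begin{bmatrix}0&\mathbf{0}_{n_m}\\ I_{d_mn_m}&0\end{bmatrix}\Big\},\quad \hat B_i=\begin{bmatrix}B_i&0\\0&H_{i0}\end{bmatrix},\quad \hat C_i=\begin{bmatrix}C_i&0\\0&H_{j_1d_{j_1}}'\\ \vdots&\vdots\\0&H_{j_{m_i}d_{j_{m_i}}}'\end{bmatrix},$$ where $\mathcal{N}_i=\{j_1,\dots,j_{m_i}\}$ and the $k$th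 diagonal block after $A$ is the $(d_k+1)n_k\times(d_k+1)n_k$ block shift matrix (zero first block row, $I_{d_kn_k}$ in the lower-left position). (This models local controllers $z_i(t+1)=v_i(t)$ with state $\mathrm{column}\{x(t),z_1(t),\dots,z_1(t-d_1),\dots,z_m(t),\dots,z_m(t-d_m)\}$, inputs $\mathrm{column}\{u_i,v_i\}$, and agent $i$ measuring $y_i(t)$ and $z_j(t-d_j)$, $j\in\mathcal{N}_i$.) Suppose $$n_i\ \ge\ n-\min_{\mathbf{s}\subset\{1,\dots,m\},\ \lambda\in\sigma(A)}\mathrm{rank}\begin{bmatrix}\lambda I_n-A & B_{\mathbf{s}}\\ C_{\{1,\dots,m\}-\mathbf{s}}&0\end{bmatrix}\quad\text{for all } i.$$ Then $\{\hat A,\hat B_i,\hat C_i;m\}$ has no fixed spectrum if and only if $\mathcal{N}_{\{1,\dots,m\}-\mathbf{s}}\cap\mathbf{s}\neq\emptyset$ for every subset $\mathbf{s}\subset\{1,\dots,m\}$ for which there is some $\lambda\in\sigma(A)$ with $\mathrm{rank}\begin{bmatrix}\lambda I_n-A&B_{\mathbf{s}}\\C_{\{1,\dots,m\}-\mathbf{s}}&0\end{bmatrix}<n$.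
   Context: Jointly controllable: $(A,[B_1\ \cdots\ B_m])$ controllable; jointly observable: $(\mathrm{column}\{C_1,\dots,C_m\},A)$ observable. The neighbor graph is a directed graph on $\{1,\dots,m\}$ with an arc $j\to i$ iff $j$ is a neighbor of $i$; $\mathcal{N}_i$ is the set of neighbors of $i$ including $i$, $\mathcal{N}_{\mathbf{s}}=\bigcup_{i\in\mathbf{s}}\mathcal{N}_i$. Agent $j$ is a follower of agent $i$ if $i\in\mathcal{N}_j$; $\mathcal{F}_i$ is the set of followers of $i$ including $i$. Weakly connected: removing self-arcs and replacing arcs by undirected edges yields a connected graph. $B_{\mathbf{s}}=[B_{i_1}\ \cdots\ B_{i_s}]$, $C_{\mathbf{s}}=\mathrm{column}\{C_{i_1},\dots,C_{i_s}\}$ for $\mathbf{s}=\{i_1<\dots<i_s\}$. The fixed spectrum of an $m$-channel system $\{A,B_i,C_i;m\}$ is the set of eigenvalues of $A+\sum_iB_iF_iC_i$ that do not change as the real matrices $F_i$ range over all values. *)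

theory Defs
  imports "Jordan_Normal_Form.DL_Rank" "Jordan_Normal_Form.Char_Poly"
begin

text \<open>Agents are indexed by 0, ..., m-1. Matrices are Jordan_Normal_Form matrices over the reals;
  eigenvalues and ranks involving complex numbers lambda are computed over the complex numbers.\<close>

definition cplx :: "real mat \<Rightarrow> complex mat" where
  "cplx M = map_mat complex_of_real M"

definition crank :: "complex mat \<Rightarrow> nat" where
  "crank M = vec_space.rank (dim_row M) M"

definition spec :: "real mat \<Rightarrow> complex set" where
  "spec A = {lam. eigenvalue (cplx A) lam}"

fun hcat :: "nat \<Rightarrow> 'a::zero mat list \<Rightarrow> 'a mat" where
  "hcat r [] = 0\<^sub>m r 0"
| "hcat r (M # Ms) = four_block_mat M (hcat r Ms) (0\<^sub>m 0 (dim_col M)) (0\<^sub>m 0 (dim_col (hcat r Ms)))"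

fun vcat :: "nat \<Rightarrow> 'a::zero mat list \<Rightarrow> 'a mat" where
  "vcat c [] = 0\<^sub>m 0 c"
| "vcat c (M # Ms) = M @\<^sub>r vcat c Ms"

fun block_diag :: "'a::zero mat list \<Rightarrow> 'a mat" where
  "block_diag [] = 0\<^sub>m 0 0"
| "block_diag (M # Ms) = four_block_mat M (0\<^sub>m (dim_row M) (dim_col (block_diag Ms)))
      (0\<^sub>m (dim_row (block_diag Ms)) (dim_col M)) (block_diag Ms)"

definition B_sub :: "nat \<Rightarrow> (nat \<Rightarrow> real mat) \<Rightarrow> nat set \<Rightarrow> real mat" where
  "B_sub n B s = hcat n (map B (sorted_list_of_set s))"

definition C_sub :: "nat \<Rightarrow> (nat \<Rightarrow> real mat) \<Rightarrow> nat set \<Rightarrow> real mat" where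
  "C_sub n C s = vcat n (map C (sorted_list_of_set s))"

definition rank_test :: "nat \<Rightarrow> real mat \<Rightarrow> (nat \<Rightarrow> real mat) \<Rightarrow> (nat \<Rightarrow> real mat) \<Rightarrow> nat \<Rightarrow> nat set \<Rightarrow> complex \<Rightarrow> nat" where
  "rank_test n A B C m s lam =
     (let Bs = cplx (B_sub n B s); Cs = cplx (C_sub n C ({0..<m} - s)) in
      crank (four_block_mat (lam \<cdot>\<^sub>m 1\<^sub>m n - cplx A) Bs Cs (0\<^sub>m (dim_row Cs) (dim_col Bs))))"

definition rrank :: "real mat \<Rightarrow> nat" where
  "rrank M = vec_space.rank (dim_row M) M"

definition controllable :: "nat \<Rightarrow> real mat \<Rightarrow> real mat \<Rightarrow> bool" where
  "controllable n A B \<longleftrightarrow> rrank (hcat n (map (\<lambda>k. (A ^\<^sub>m k) * B) [0..<n])) = n"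

definition observable :: "nat \<Rightarrow> real mat \<Rightarrow> real mat \<Rightarrow> bool" where
  "observable n C A \<longleftrightarrow> rrank (vcat n (map (\<lambda>k. C * (A ^\<^sub>m k)) [0..<n])) = n"

text \<open>Neighbor graph: N i is the set of neighbors of i, including i.\<close>
definition followers :: "nat \<Rightarrow> (nat \<Rightarrow> nat set) \<Rightarrow> nat \<Rightarrow> nat set" where
  "followers m N i = {j \<in> {0..<m}. i \<in> N j}"

definition N_set :: "(nat \<Rightarrow> nat set) \<Rightarrow> nat set \<Rightarrow> nat set" where
  "N_set N s = (\<Union>i\<in>s. N i)"

definition weakly_connected :: "nat \<Rightarrow> (nat \<Rightarrow> nat set) \<Rightarrow> bool" where
  "weakly_connected m N \<longleftrightarrow>
     (\<forall>i<m. \<forall>j<m. (\<lambda>a b. a < m \<and> b < m \<and> a \<noteq> b \<and> (a \<in> N b \<or> b \<in> N a))\<^sup>*\<^sup>* i j)"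

definition dmax :: "nat \<Rightarrow> (nat \<Rightarrow> nat set) \<Rightarrow> (nat \<Rightarrow> nat \<Rightarrow> nat) \<Rightarrow> nat \<Rightarrow> nat" where
  "dmax m N d i = Max ((d i) ` followers m N i)"

definition Nz :: "nat \<Rightarrow> (nat \<Rightarrow> nat) \<Rightarrow> (nat \<Rightarrow> nat) \<Rightarrow> nat" where
  "Nz m dm nn = (\<Sum>k<m. (dm k + 1) * nn k)"

definition offs :: "(nat \<Rightarrow> nat) \<Rightarrow> (nat \<Rightarrow> nat) \<Rightarrow> nat \<Rightarrow> nat" where
  "offs dm nn k = (\<Sum>l<k. (dm l + 1) * nn l)"

text \<open>H_{i delta}: N_z x n_i, i-th block = column{0_{delta n_i x n_i}, I_{n_i}, 0}.\<close>
definition H :: "nat \<Rightarrow> (nat \<Rightarrow> nat) \<Rightarrow> (nat \<Rightarrow> nat) \<Rightarrow> nat \<Rightarrow> nat \<Rightarrow> real mat" where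
  "H m dm nn i \<delta> = mat (Nz m dm nn) (nn i)
     (\<lambda>(r, c). if r = offs dm nn i + \<delta> * nn i + c then 1 else 0)"

definition shift_blk :: "nat \<Rightarrow> nat \<Rightarrow> real mat" where
  "shift_blk d k = mat ((d + 1) * k) ((d + 1) * k) (\<lambda>(r, c). if r = c + k then 1 else 0)"

definition A_hat :: "real mat \<Rightarrow> nat \<Rightarrow> (nat \<Rightarrow> nat) \<Rightarrow> (nat \<Rightarrow> nat) \<Rightarrow> real mat" where
  "A_hat A m dm nn = block_diag (A # map (\<lambda>k. shift_blk (dm k) (nn k)) [0..<m])"

definition B_hat :: "nat \<Rightarrow> (nat \<Rightarrow> real mat) \<Rightarrow> nat \<Rightarrow> (nat \<Rightarrow> nat) \<Rightarrow> (nat \<Rightarrow> nat) \<Rightarrow> nat \<Rightarrow> real mat" where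
  "B_hat n B m dm nn i = four_block_mat (B i) (0\<^sub>m n (nn i))
      (0\<^sub>m (Nz m dm nn) (dim_col (B i))) (H m dm nn i 0)"

definition C_hat :: "nat \<Rightarrow> (nat \<Rightarrow> real mat) \<Rightarrow> nat \<Rightarrow> (nat \<Rightarrow> nat set) \<Rightarrow> (nat \<Rightarrow> nat) \<Rightarrow> (nat \<Rightarrow> nat) \<Rightarrow> nat \<Rightarrow> real mat" where
  "C_hat n C m N dm nn i =
     (let G = vcat (Nz m dm nn) (map (\<lambda>j. transpose_mat (H m dm nn j (dm j))) (sorted_list_of_set (N i)))
      in four_block_mat (C i) (0\<^sub>m (dim_row (C i)) (Nz m dm nn)) (0\<^sub>m (dim_row G) n) G)"

definition fixed_spectrum :: "real mat \<Rightarrow> (nat \<Rightarrow> real mat) \<Rightarrow> (nat \<Rightarrow> real mat) \<Rightarrow> nat \<Rightarrow> complex set" where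
  "fixed_spectrum A B C m =
     {lam. \<forall>F :: nat \<Rightarrow> real mat. (\<forall>i<m. F i \<in> carrier_mat (dim_col (B i)) (dim_row (C i))) \<longrightarrow>
          eigenvalue (cplx (foldl (\<lambda>M i. M + B i * F i * C i) A [0..<m])) lam}"

end

theory Submission
  imports Defs
begin

text \<open>Write $Q_s(\lambda)$ for the matrix in the rank condition. The proof rests on the classical
  characterisation that $\lambda$ is a fixed eigenvalue of an $n$-dimensional multichannel system iff
  $\mathrm{rank}\,Q_s(\lambda) < n$ for some set $s$ of channels, applied to the extended system.
  There $Q_s$ splits into the plant part and one block per memory chain, and the chain of agent $k$
  contributes rank $(d_k+1)n_k$, plus $n_k$ if $k$ lies in both $s$ and
  $\mathcal{N}_{\{1,\dots,m\}-s}$, where the chain is driven and observed. So $\lambda$ is not fixed iff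
  $\mathrm{rank}\,Q_s(\lambda) + \sum n_k \ge n$ for all $s$, the sum being over that intersection,
  and by the assumption on the $n_i$ one index in the intersection suffices.

  For the characterisation itself, feedback is added one scalar channel $t\,b\,c$ at a time.
  If two different values of $t$ both give $M + t\,b\,c$ rank at most $r$, then bordering $M$ by
  the column $b$ or by the row $c$ already has rank at most $r$. Hence a generic real $t$ preserves
  the rank lower bounds for all finitely many sets of remaining channels simultaneously.\<close>

section \<open>Rank by factorisation\<close>

text \<open>Only upper bounds on ranks are needed, each witnessed by a factorisation through
  \<open>r\<close> intermediate indices. Such a bound ignores the order and repetition of rows and
  columns, and repetition does occur: several agents may measure the same delayed state. The easy
  half of the characterisation is then direct, since feedback can be absorbed into the two factors.
  The other half meets two obstacles. The gains are real while lambda is complex, which is harmless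
  as long as only finitely many real values of a gain have to be avoided. And a gain matrix is not a
  scalar channel: each of its entries is made one, so the same input column and output row are
  shared by many scalar channels, and an arbitrary set of these has to be traced back to a set of
  agents.\<close>

text \<open>Stated for arrays with arbitrary index types, so that rows and columns can be dropped, duplicated
  and renamed freely.\<close>

definition rank_le :: "'i set \<Rightarrow> 'j set \<Rightarrow> ('i \<Rightarrow> 'j \<Rightarrow> 'a::field) \<Rightarrow> nat \<Rightarrow> bool" where
  "rank_le I J f r \<longleftrightarrow> (\<exists>u v. \<forall>i\<in>I. \<forall>j\<in>J. f i j = (\<Sum>k<r. u i k * v j k))"

lemma rank_leI:
  assumes "finite K" "card K \<le> r"
    and eq: "\<And>i j. i \<in> I \<Longrightarrow> j \<in> J \<Longrightarrow> f i j = (\<Sum>k\<in>K. u i k * v j k)"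
  shows "rank_le I J f r"
proof -
  obtain g where g: "bij_betw g {..<card K} K"
    using ex_bij_betw_nat_finite[OF assms(1)] by (auto simp: lessThan_atLeast0)
  define u' where "u' i k = (if k < card K then u i (g k) else 0)" for i k
  have "f i j = (\<Sum>k<r. u' i k * v j (g k))" if "i \<in> I" "j \<in> J" for i j
  proof -
    have "f i j = (\<Sum>k<card K. u i (g k) * v j (g k))"
      unfolding eq[OF that] by (rule sum.reindex_bij_betw[OF g, symmetric])
    also have "\<dots> = (\<Sum>k<card K. u' i k * v j (g k))"
      by (intro sum.cong) (auto simp: u'_def)
    also have "\<dots> = (\<Sum>k<r. u' i k * v j (g k))"
      using assms(2) by (intro sum.mono_neutral_left) (auto simp: u'_def)
    finally show ?thesis .
  qed
  then show ?thesis unfolding rank_le_def by (intro exI[of _ u'] exI[of _ "\<lambda>j k. v j (g k)"]) auto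
qed

lemma rank_leE:
  assumes "rank_le I J f r"
  obtains u v where "\<And>i j. i \<in> I \<Longrightarrow> j \<in> J \<Longrightarrow> f i j = (\<Sum>k<r. u i k * v j k)"
  using assms unfolding rank_le_def by blast

lemma rank_le_mono: "rank_le I J f r \<Longrightarrow> r \<le> r' \<Longrightarrow> rank_le I J f r'"
  by (elim rank_leE) (rule rank_leI[of "{..<r}"], auto)

text \<open>Relations rather than maps: each index of the new array needs only one partner, so
  repeated rows and columns cost nothing. A relation together with its converse then shows that two
  arrays satisfy the same bounds.\<close>

lemma rank_le_rel:
  assumes "rank_le I' J' f' r"
    and "\<And>i. i \<in> I \<Longrightarrow> \<exists>i'\<in>I'. R i i'" "\<And>j. j \<in> J \<Longrightarrow> \<exists>j'\<in>J'. S j j'"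
    and eq: "\<And>i i' j j'. R i i' \<Longrightarrow> S j j' \<Longrightarrow> f i j = f' i' j'"
  shows "rank_le I J f r"
proof -
  obtain u v where uv: "\<And>i j. i \<in> I' \<Longrightarrow> j \<in> J' \<Longrightarrow> f' i j = (\<Sum>k<r. u i k * v j k)"
    using rank_leE[OF assms(1)] by blast
  obtain g where g: "\<And>i. i \<in> I \<Longrightarrow> g i \<in> I' \<and> R i (g i)" using assms(2) by metis
  obtain h where h: "\<And>j. j \<in> J \<Longrightarrow> h j \<in> J' \<and> S j (h j)" using assms(3) by metis
  show ?thesis
  proof (rule rank_leI[of "{..<r}"])
    fix i j assume "i \<in> I" "j \<in> J"
    with g h eq uv show "f i j = (\<Sum>k\<in>{..<r}. u (g i) k * v (h j) k)" by metis
  qed auto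
qed

lemma rank_le_subset: "rank_le I' J' f r \<Longrightarrow> I \<subseteq> I' \<Longrightarrow> J \<subseteq> J' \<Longrightarrow> rank_le I J f r"
  by (erule rank_le_rel[where R = "(=)" and S = "(=)"]) auto

lemma rank_le_cong:
  "rank_le I J f r \<Longrightarrow> (\<And>i j. i \<in> I \<Longrightarrow> j \<in> J \<Longrightarrow> f i j = g i j) \<Longrightarrow> rank_le I J g r"
  unfolding rank_le_def by simp

lemma rank_le_transpose: "rank_le I J f r \<Longrightarrow> rank_le J I (\<lambda>j i. f i j) r"
  unfolding rank_le_def by (subst mult.commute) blast

lemma rank_le_extend_zero:
  assumes "rank_le I J f r"
    and "\<And>i j. i \<in> I' \<Longrightarrow> j \<in> J' \<Longrightarrow> \<not> (i \<in> I \<and> j \<in> J) \<Longrightarrow> f i j = 0"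
  shows "rank_le I' J' f r"
proof -
  obtain u v where uv: "\<And>i j. i \<in> I \<Longrightarrow> j \<in> J \<Longrightarrow> f i j = (\<Sum>k<r. u i k * v j k)"
    using rank_leE[OF assms(1)] by blast
  show ?thesis
  proof (rule rank_leI[of "{..<r}" _ _ _ _ "\<lambda>i k. if i \<in> I then u i k else 0"
        "\<lambda>j k. if j \<in> J then v j k else 0"], goal_cases)
    case (3 i j)
    with uv assms(2) show ?case by (cases "i \<in> I"; cases "j \<in> J") auto
  qed auto
qed

lemma rank_le_insert_col:
  assumes "rank_le I J f r"
  shows "rank_le I (insert j0 J) f (Suc r)"
proof -
  obtain u v where uv: "\<And>i j. i \<in> I \<Longrightarrow> j \<in> J \<Longrightarrow> f i j = (\<Sum>k<r. u i k * v j k)"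
    using rank_leE[OF assms(1)] by blast
  show ?thesis
  \<comment> \<open>The extra term \<open>k = r\<close> carries the whole column \<open>j0\<close>.
    Its old coefficients are dropped, so \<open>j0\<close> may already lie in
    \<open>J\<close>.\<close>
  proof (rule rank_leI[of "{..<Suc r}" _ _ _ _ "\<lambda>i k. if k = r then f i j0 else u i k"
        "\<lambda>j k. if j = j0 then of_bool (k = r) else if k = r then 0 else v j k"], goal_cases)
    case (3 i j)
    have "(\<Sum>k<r. (if k = r then f i j0 else u i k) * of_bool (k = r)) = 0"
      by (intro sum.neutral) auto
    with 3 uv show ?case by auto
  qed auto
qed

lemma rank_le_add_cols:
  assumes "finite J0" "rank_le I J f r"
  shows "rank_le I (J \<union> J0) f (r + card J0)"
  using assms by induction (auto intro: rank_le_insert_col simp: insert_absorb)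

lemma rank_le_add_rows:
  assumes "finite I0" "rank_le I J f r"
  shows "rank_le (I \<union> I0) J f (r + card I0)"
  using rank_le_transpose[OF rank_le_add_cols[OF assms(1) rank_le_transpose[OF assms(2)]]] by simp

section \<open>Products, elimination and triangular pivots\<close>

lemma rank_le_mult_left:
  assumes "rank_le I J f r" "finite I"
  shows "rank_le I' J (\<lambda>i' j. \<Sum>i\<in>I. z i' i * f i j) r"
proof -
  obtain u v where uv: "\<And>i j. i \<in> I \<Longrightarrow> j \<in> J \<Longrightarrow> f i j = (\<Sum>k<r. u i k * v j k)"
    using rank_leE[OF assms(1)] by blast
  show ?thesis
  proof (rule rank_leI[of "{..<r}" _ _ _ _ "\<lambda>i' k. \<Sum>i\<in>I. z i' i * u i k" v], goal_cases)
    case (3 i' j)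
    have "(\<Sum>i\<in>I. z i' i * f i j) = (\<Sum>i\<in>I. \<Sum>k<r. z i' i * u i k * v j k)"
      using 3 uv by (auto simp: sum_distrib_left algebra_simps intro!: sum.cong)
    also have "\<dots> = (\<Sum>k<r. (\<Sum>i\<in>I. z i' i * u i k) * v j k)"
      unfolding sum_distrib_right by (rule sum.swap)
    finally show ?case .
  qed auto
qed

text \<open>The vector \<open>v j0\<close> is nonzero and pairs to zero with every
  \<open>u i\<close> for \<open>i\<close> in \<open>I\<close>, because column \<open>j0\<close>
  vanishes there. These \<open>u i\<close> lie in a hyperplane, so one coordinate is a combination
  of the others and can be eliminated.\<close>

lemma rank_le_eliminate:
  fixes f :: "'i \<Rightarrow> 'j \<Rightarrow> 'a::field"
  assumes "rank_le (insert i0 I) (insert j0 J) f r"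
    and nz: "f i0 j0 \<noteq> 0" and z: "\<And>i. i \<in> I \<Longrightarrow> f i j0 = 0"
  shows "r > 0 \<and> rank_le I J f (r - 1)"
proof -
  obtain u v where uv: "\<And>i j. i \<in> insert i0 I \<Longrightarrow> j \<in> insert j0 J \<Longrightarrow> f i j = (\<Sum>k<r. u i k * v j k)"
    using rank_leE[OF assms(1)] by blast
  have "(\<Sum>k<r. u i0 k * v j0 k) \<noteq> 0" using nz uv by auto
  then obtain l where l: "l < r" "v j0 l \<noteq> 0"
    by (metis (no_types, lifting) lessThan_iff mult_zero_right sum.neutral)
  have "rank_le I J f (r - 1)"
  \<comment> \<open>Solving for coordinate \<open>l\<close> of \<open>u i\<close> changes only the
    right factor.\<close>
  proof (rule rank_leI[of "{..<r} - {l}" _ _ _ _ u "\<lambda>j k. v j k - v j0 k / v j0 l * v j l"], goal_cases)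
    case (3 i j)
    have "0 = (\<Sum>k<r. u i k * v j0 k)" using uv z 3 by (metis insertCI)
    also have "\<dots> = u i l * v j0 l + (\<Sum>k\<in>{..<r}-{l}. u i k * v j0 k)"
      by (subst sum.remove[of _ l]) (use l in auto)
    finally have "u i l * v j0 l = - (\<Sum>k\<in>{..<r}-{l}. u i k * v j0 k)"
      by (metis add_eq_0_iff2)
    then have ul: "u i l = - (\<Sum>k\<in>{..<r}-{l}. u i k * v j0 k) / v j0 l"
      using l by (simp add: field_simps)
    have "f i j = u i l * v j l + (\<Sum>k\<in>{..<r}-{l}. u i k * v j k)"
      using 3 uv by (subst sum.remove[of _ l, symmetric]) (use l in auto)
    also have "\<dots> = (\<Sum>k\<in>{..<r}-{l}. u i k * (v j k - v j0 k / v j0 l * v j l))"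
      by (subst ul) (simp add: algebra_simps sum_subtractf sum_distrib_left sum_divide_distrib)
    finally show ?case .
  qed (use l in auto)
  with l show ?thesis by auto
qed

text \<open>Pivots are split off by increasing level: the column of a pivot of least level vanishes
  in \<open>I\<close> and in all other pivot rows, as \<open>rank_le_eliminate\<close> requires. The
  array is only block triangular: pivot rows may be nonzero in the columns \<open>J\<close>.\<close>

lemma rank_le_triangular:
  fixes f :: "'i \<Rightarrow> 'j \<Rightarrow> 'a::field" and lev :: "'p \<Rightarrow> nat"
  assumes "finite P" "rank_le (I \<union> \<rho> ` P) (J \<union> \<gamma> ` P) f r"
    and "\<And>p. p \<in> P \<Longrightarrow> f (\<rho> p) (\<gamma> p) \<noteq> 0"
    and "\<And>i p. i \<in> I \<Longrightarrow> p \<in> P \<Longrightarrow> f i (\<gamma> p) = 0"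
    and "\<And>p p'. p \<in> P \<Longrightarrow> p' \<in> P \<Longrightarrow> p \<noteq> p' \<Longrightarrow> lev p \<le> lev p' \<Longrightarrow> f (\<rho> p') (\<gamma> p) = 0"
  shows "card P \<le> r \<and> rank_le I J f (r - card P)"
  using assms
proof (induction "card P" arbitrary: P r)
  case 0
  then show ?case by simp
next
  case (Suc k)
  then have "P \<noteq> {}" by auto
  define p where "p = arg_min_on lev P"
  have p: "p \<in> P" "\<And>p'. p' \<in> P \<Longrightarrow> lev p \<le> lev p'"
    unfolding p_def using arg_min_if_finite[OF \<open>finite P\<close> \<open>P \<noteq> {}\<close>, of lev]
    by (auto simp: not_less)
  define P' where "P' = P - {p}"
  have P: "P = insert p P'" "p \<notin> P'" "finite P'" "card P = Suc (card P')"
    using p Suc.prems(1) by (auto simp: P'_def card.remove simp del: card_Diff_insert)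
  have "r > 0 \<and> rank_le (I \<union> \<rho> ` P') (J \<union> \<gamma> ` P') f (r - 1)"
  proof (rule rank_le_eliminate[of "\<rho> p" _ "\<gamma> p"])
    show "rank_le (insert (\<rho> p) (I \<union> \<rho> ` P')) (insert (\<gamma> p) (J \<union> \<gamma> ` P')) f r"
      using Suc.prems(2) P by simp
    show "f i (\<gamma> p) = 0" if "i \<in> I \<union> \<rho> ` P'" for i
      using that Suc.prems(4,5) p P by blast
  qed (use p Suc.prems in auto)
  moreover have "card P' \<le> r - 1 \<and> rank_le I J f (r - 1 - card P')" if "rank_le (I \<union> \<rho> ` P') (J \<union> \<gamma> ` P') f (r - 1)"
    by (rule Suc.hyps(1)) (use that P Suc in auto)
  ultimately show ?case using P by auto
qed

lemma rank_le_identity: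
  assumes "finite P" "rank_le P P (\<lambda>i j. of_bool (i = j) :: 'a::field) r"
  shows "card P \<le> r"
  using rank_le_triangular[of P "{}" "\<lambda>x. x" "{}" "\<lambda>x. x" "\<lambda>i j. of_bool (i = j) :: 'a" r "\<lambda>_. 0"] assms
  by auto

section \<open>Kernels and row spaces\<close>

text \<open>By induction on the functionals: if some \<open>x0\<close> is killed by the old ones but
  not by \<open>f i0\<close>, subtracting a multiple of \<open>f i0\<close> makes \<open>c\<close>
  vanish at \<open>x0\<close>, and every vector killed by the old ones can be moved along
  \<open>x0\<close> into the kernel of \<open>f i0\<close>. This makes row-space arguments available
  for arrays.\<close>

lemma functional_in_span:
  fixes f :: "'i \<Rightarrow> 'j \<Rightarrow> 'a::field"
  assumes "finite I"
    and "\<And>x. (\<And>i. i \<in> I \<Longrightarrow> (\<Sum>j\<in>J. f i j * x j) = 0) \<Longrightarrow> (\<Sum>j\<in>J. c j * x j) = 0"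
    and J: "finite J"
  shows "\<exists>y. \<forall>j\<in>J. c j = (\<Sum>i\<in>I. y i * f i j)"
  using assms(1,2)
proof (induction I arbitrary: c)
  case empty
  have "c j = 0" if "j \<in> J" for j
    using empty(1)[of "\<lambda>k. of_bool (k = j)"] that J by (simp add: of_bool_def if_distrib sum.delta cong: if_cong)
  then show ?case by auto
next
  case (insert i0 I)
  define ap where "ap c x = (\<Sum>j\<in>J. c j * x j)" for c x :: "'j \<Rightarrow> 'a"
  show ?case
  proof (cases "\<exists>x. (\<forall>i\<in>I. ap (f i) x = 0) \<and> ap (f i0) x \<noteq> 0")
    case False
    then obtain y where y: "\<forall>j\<in>J. c j = (\<Sum>i\<in>I. y i * f i j)"
      using insert.IH[of c] insert.prems unfolding ap_def by blast
    define y' where "y' = y(i0 := 0)"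
    have "\<forall>j\<in>J. c j = (\<Sum>i\<in>insert i0 I. y' i * f i j)"
      using y insert.hyps by (auto simp: y'_def intro!: sum.cong)
    then show ?thesis by blast
  next
    case True
    then obtain x0 where x0: "\<forall>i\<in>I. ap (f i) x0 = 0" "ap (f i0) x0 \<noteq> 0" by blast
    define a where "a = ap c x0 / ap (f i0) x0"
    have lin: "ap (\<lambda>j. c j - a * g j) x = ap c x - a * ap g x"
      "ap c (\<lambda>j. x j - a * g j) = ap c x - a * ap c g" for c g x a
      by (simp_all add: ap_def algebra_simps sum_subtractf sum_distrib_left)
    have "ap (\<lambda>j. c j - a * f i0 j) x = 0" if x: "\<And>i. i \<in> I \<Longrightarrow> ap (f i) x = 0" for x
    proof -
      define t where "t = ap (f i0) x / ap (f i0) x0"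
      have "ap c (\<lambda>j. x j - t * x0 j) = 0"
        unfolding ap_def
      proof (rule insert.prems, fold ap_def)
        fix i assume "i \<in> insert i0 I"
        then show "ap (f i) (\<lambda>j. x j - t * x0 j) = 0"
          using x x0 unfolding lin by (auto simp: t_def)
      qed
      then show ?thesis using x0 unfolding lin by (simp add: a_def t_def)
    qed
    then obtain y where y: "\<forall>j\<in>J. c j - a * f i0 j = (\<Sum>i\<in>I. y i * f i j)"
      using insert.IH[of "\<lambda>j. c j - a * f i0 j"] unfolding ap_def by blast
    define y' where "y' = y(i0 := a)"
    have "(\<Sum>i\<in>I. y' i * f i j) = (\<Sum>i\<in>I. y i * f i j)" for j
      using insert.hyps by (auto simp: y'_def intro!: sum.cong)
    then have "\<forall>j\<in>J. c j = (\<Sum>i\<in>insert i0 I. y' i * f i j)"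
      using y insert.hyps by (auto simp: y'_def diff_eq_eq add.commute)
    then show ?thesis by blast
  qed
qed

text \<open>Each row of \<open>h\<close> vanishes on the kernel of \<open>f\<close>, hence is a
  combination of rows of \<open>f\<close>.\<close>

lemma rank_le_kernel_subset:
  fixes f :: "'i \<Rightarrow> 'j \<Rightarrow> 'a::field" and h :: "'k \<Rightarrow> 'j \<Rightarrow> 'a"
  assumes "rank_le I J f r" "finite I" "finite J"
    and ker: "\<And>x k. k \<in> K \<Longrightarrow> (\<And>i. i \<in> I \<Longrightarrow> (\<Sum>j\<in>J. f i j * x j) = 0) \<Longrightarrow> (\<Sum>j\<in>J. h k j * x j) = 0"
  shows "rank_le K J h r"
proof -
  have "\<exists>y. \<forall>j\<in>J. h k j = (\<Sum>i\<in>I. y i * f i j)" if "k \<in> K" for k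
    by (rule functional_in_span) (use assms that in auto)
  then obtain y where "\<And>k j. k \<in> K \<Longrightarrow> j \<in> J \<Longrightarrow> h k j = (\<Sum>i\<in>I. y k i * f i j)"
    by metis
  then show ?thesis
    using rank_le_mult_left[OF assms(1,2), of K y] by (auto elim: rank_le_cong)
qed

text \<open>A trivial kernel lies in every kernel, so the identity array inherits the bound
  \<open>r\<close>.\<close>

lemma trivial_kernel_rank:
  fixes f :: "'i \<Rightarrow> 'j \<Rightarrow> 'a::field"
  assumes "rank_le I J f r" "finite I" "finite J"
    and ker: "\<And>x j. (\<And>i. i \<in> I \<Longrightarrow> (\<Sum>j\<in>J. f i j * x j) = 0) \<Longrightarrow> j \<in> J \<Longrightarrow> x j = 0"
  shows "card J \<le> r"
proof (rule rank_le_identity)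
  show "rank_le J J (\<lambda>i j. of_bool (i = j) :: 'a) r"
  proof (rule rank_le_kernel_subset[OF assms(1-3)])
    fix x k assume "k \<in> J" "\<And>i. i \<in> I \<Longrightarrow> (\<Sum>j\<in>J. f i j * x j) = 0"
    then have "x k = 0" using ker[of x k] by blast
    then show "(\<Sum>j\<in>J. of_bool (k = j) * x j) = 0"
      by (intro sum.neutral) auto
  qed
qed fact

lemma singular_iff_rank_le:
  fixes f :: "'i \<Rightarrow> 'i \<Rightarrow> 'a::field"
  assumes "finite I" "I \<noteq> {}"
  shows "(\<exists>x. (\<exists>i\<in>I. x i \<noteq> 0) \<and> (\<forall>i\<in>I. (\<Sum>j\<in>I. f i j * x j) = 0)) \<longleftrightarrow> rank_le I I f (card I - 1)"
proof
  assume "\<exists>x. (\<exists>i\<in>I. x i \<noteq> 0) \<and> (\<forall>i\<in>I. (\<Sum>j\<in>I. f i j * x j) = 0)"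
  then obtain x l where x: "l \<in> I" "x l \<noteq> 0" "\<forall>i\<in>I. (\<Sum>j\<in>I. f i j * x j) = 0" by blast
  \<comment> \<open>A kernel vector with \<open>x l\<close> nonzero expresses column
    \<open>l\<close> through the others, which form the left factor.\<close>
  show "rank_le I I f (card I - 1)"
  proof (rule rank_leI[of "I - {l}" _ _ _ _ f
        "\<lambda>j k. if j = l then - x k / x l else of_bool (j = k)"], goal_cases)
    case (3 i j)
    show ?case
    proof (cases "j = l")
      case True
      have "0 = (\<Sum>j\<in>I. f i j * x j)" using x(3) 3(1) by simp
      also have "\<dots> = f i l * x l + (\<Sum>k\<in>I-{l}. f i k * x k)"
        using x assms(1) by (simp add: sum.remove)
      finally have "f i l * x l = - (\<Sum>k\<in>I-{l}. f i k * x k)" by (metis add_eq_0_iff2)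
      then have "f i l = - (\<Sum>k\<in>I-{l}. f i k * x k) / x l" using x by (simp add: field_simps)
      with True show ?thesis by (simp add: sum_divide_distrib sum_negf)
    next
      case False
      with 3 assms(1) show ?thesis
        by (simp add: of_bool_def if_distrib sum.delta' cong: if_cong)
    qed
  qed (use assms x in auto)
next
  assume r: "rank_le I I f (card I - 1)"
  show "\<exists>x. (\<exists>i\<in>I. x i \<noteq> 0) \<and> (\<forall>i\<in>I. (\<Sum>j\<in>I. f i j * x j) = 0)"
  proof (rule ccontr)
    assume "\<not> ?thesis"
    then have "card I \<le> card I - 1"
      by (intro trivial_kernel_rank[OF r]) (use assms in auto)
    moreover have "0 < card I" using assms by (simp add: card_gt_0_iff)
    ultimately show False by linarith
  qed
qed

section \<open>Rank-one updates\<close>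

text \<open>If $b$ is in the column span of $f + t\,b\,c$, then appending it as a column does not raise the rank.
  Otherwise the kernel of $f + t'b\,c$ is contained in those of $c$ and $f$.\<close>

lemma rank_one_update:
  fixes f :: "'i \<Rightarrow> 'j \<Rightarrow> 'a::field"
  assumes fin: "finite I" "finite J"
    and "rank_le I J (\<lambda>i j. f i j + t * b i * c j) r"
    and "rank_le I J (\<lambda>i j. f i j + t' * b i * c j) r"
    and "t \<noteq> t'"
  shows "rank_le I (insert None (Some ` J)) (\<lambda>i j. case j of None \<Rightarrow> b i | Some j \<Rightarrow> f i j) r
       \<or> rank_le (insert None (Some ` I)) J (\<lambda>i j. case i of None \<Rightarrow> c j | Some i \<Rightarrow> f i j) r"
proof (cases "\<exists>w. \<forall>i\<in>I. b i = (\<Sum>j\<in>J. (f i j + t * b i * c j) * w j)")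
  case True
  then obtain w where w: "\<forall>i\<in>I. b i = (\<Sum>j\<in>J. (f i j + t * b i * c j) * w j)" by blast
  \<comment> \<open>The combination \<open>w\<close> yields \<open>b\<close>. Subtracting
    \<open>t * c j'\<close> times it from a column of the updated array recovers the column of
    \<open>f\<close>.\<close>
  define z where "z j' j = (case j' of None \<Rightarrow> w j | Some j' \<Rightarrow> of_bool (j = j') - t * c j' * w j)" for j' j
  have "rank_le I (insert None (Some ` J)) (\<lambda>i j'. \<Sum>j\<in>J. z j' j * (f i j + t * b i * c j)) r"
    using rank_le_transpose[OF rank_le_mult_left[OF rank_le_transpose[OF assms(3)] fin(2), of _ z]] .
  then have "rank_le I (insert None (Some ` J)) (\<lambda>i j. case j of None \<Rightarrow> b i | Some j \<Rightarrow> f i j) r"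
  proof (rule rank_le_cong, goal_cases)
    case (1 i j')
    show ?case
    proof (cases j')
      case None
      then show ?thesis using w 1 by (simp add: z_def mult.commute)
    next
      case (Some j0)
      with 1 have j0: "j0 \<in> J" by auto
      have "(\<Sum>j\<in>J. z j' j * (f i j + t * b i * c j))
          = (\<Sum>j\<in>J. of_bool (j = j0) * (f i j + t * b i * c j)) - t * c j0 * (\<Sum>j\<in>J. (f i j + t * b i * c j) * w j)"
        unfolding sum_distrib_left sum_subtractf[symmetric]
        by (intro sum.cong) (auto simp: z_def Some algebra_simps)
      also have "(\<Sum>j\<in>J. of_bool (j = j0) * (f i j + t * b i * c j)) = f i j0 + t * b i * c j0"
        using j0 fin by (simp add: of_bool_def if_distrib if_distribR sum.delta cong: if_cong)
      also have "(\<Sum>j\<in>J. (f i j + t * b i * c j) * w j) = b i" using w 1 by simp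
      finally show ?thesis by (simp add: Some)
    qed
  qed
  then show ?thesis by blast
next
  case False
  have "rank_le (insert None (Some ` I)) J (\<lambda>i j. case i of None \<Rightarrow> c j | Some i \<Rightarrow> f i j) r"
  proof (rule rank_le_kernel_subset[OF assms(4) fin])
    fix x k assume k: "k \<in> insert None (Some ` I)"
      and x: "\<And>i. i \<in> I \<Longrightarrow> (\<Sum>j\<in>J. (f i j + t' * b i * c j) * x j) = 0"
    define cx where "cx = (\<Sum>j\<in>J. c j * x j)"
    have exp: "(\<Sum>j\<in>J. (f i j + s * b i * c j) * x j) = (\<Sum>j\<in>J. f i j * x j) + s * b i * cx" for s i
      unfolding cx_def sum_distrib_left sum.distrib[symmetric]
      by (intro sum.cong) (auto simp: algebra_simps)
    have fx: "(\<Sum>j\<in>J. f i j * x j) = - t' * b i * cx" if "i \<in> I" for i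
      using x[OF that] unfolding exp by (simp add: add_eq_0_iff2)
    have cx: "cx = 0"
    proof (rule ccontr)
      assume "cx \<noteq> 0"
      \<comment> \<open>On a kernel vector \<open>x\<close> of the array with \<open>t'\<close>, the
        array with \<open>t\<close> takes the value \<open>(t - t') * cx * b\<close>. Dividing by
        the scalar puts \<open>b\<close> into the excluded span.\<close>
      define w where "w j = x j / (cx * (t - t'))" for j
      have "b i = (\<Sum>j\<in>J. (f i j + t * b i * c j) * w j)" if "i \<in> I" for i
      proof -
        have "(\<Sum>j\<in>J. (f i j + t * b i * c j) * w j) = (\<Sum>j\<in>J. (f i j + t * b i * c j) * x j) / (cx * (t - t'))"
          by (simp add: w_def sum_divide_distrib)
        also have "\<dots> = b i * (cx * (t - t')) / (cx * (t - t'))"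
          unfolding exp fx[OF that] by (simp add: algebra_simps)
        also have "\<dots> = b i" using \<open>cx \<noteq> 0\<close> assms(5) by simp
        finally show ?thesis by simp
      qed
      with False show False by blast
    qed
    with k fx show "(\<Sum>j\<in>J. (case k of None \<Rightarrow> c j | Some i \<Rightarrow> f i j) * x j) = 0"
      by (auto simp: cx_def)
  qed
  then show ?thesis by blast
qed

section \<open>Output feedback over many channels\<close>

text \<open>The block matrix $[f, b; c, 0]$. Its choice of channels lives only in the index sets.\<close>

definition bordered ::
    "('i \<Rightarrow> 'j \<Rightarrow> 'a::zero) \<Rightarrow> ('e \<Rightarrow> 'i \<Rightarrow> 'a) \<Rightarrow> ('g \<Rightarrow> 'j \<Rightarrow> 'a) \<Rightarrow> 'i + 'g \<Rightarrow> 'j + 'e \<Rightarrow> 'a" where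
  "bordered f b c x y =
     (case x of Inl i \<Rightarrow> (case y of Inl j \<Rightarrow> f i j | Inr e \<Rightarrow> b e i)
      | Inr g \<Rightarrow> (case y of Inl j \<Rightarrow> c g j | Inr e \<Rightarrow> 0))"

lemma bordered_simps [simp]:
  "bordered f b c (Inl i) (Inl j) = f i j" "bordered f b c (Inl i) (Inr e) = b e i"
  "bordered f b c (Inr g) (Inl j) = c g j" "bordered f b c (Inr g) (Inr e) = 0"
  by (simp_all add: bordered_def)

text \<open>The hypothesis ranges over all \<open>T\<close> because the two outcomes of
  \<open>rank_one_update\<close> are exactly the channel \<open>e\<close> entering as a column
  (\<open>e\<close> in \<open>T\<close>) or as a row (\<open>e\<close> outside \<open>T\<close>). A
  closed channel becomes part of the matrix, so the induction needs \<open>f\<close>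
  arbitrary.\<close>

lemma scalar_channels:
  fixes f :: "'i \<Rightarrow> 'j \<Rightarrow> complex" and b :: "'e \<Rightarrow> 'i \<Rightarrow> complex" and c :: "'e \<Rightarrow> 'j \<Rightarrow> complex"
  assumes "finite E" "finite I" "finite J"
    and "\<And>T. T \<subseteq> E \<Longrightarrow> \<not> rank_le (I <+> (E - T)) (J <+> T) (bordered f b c) r"
  shows "\<exists>t :: 'e \<Rightarrow> real. \<not> rank_le I J (\<lambda>i j. f i j + (\<Sum>e\<in>E. of_real (t e) * b e i * c e j)) r"
  using assms(1,4)
proof (induction E arbitrary: f)
  case empty
  have "\<not> rank_le I J f r"
  proof
    assume "rank_le I J f r"
    then have "rank_le (I <+> ({} :: 'e set)) (J <+> ({} :: 'e set)) (bordered f b c) r"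
      by (rule rank_le_rel[where R = "\<lambda>x i. x = Inl i" and S = "\<lambda>x j. x = Inl j"]) auto
    with empty[of "{}"] show False by simp
  qed
  then show ?case by auto
next
  case (insert e E)
  let ?g = "\<lambda>t :: real. \<lambda>i j. f i j + of_real t * b e i * c e j"
  let ?bad = "\<lambda>T. {t. rank_le (I <+> (E - T)) (J <+> T) (bordered (?g t) b c) r}"
  have "finite (?bad T)" if T: "T \<subseteq> E" for T
  proof -
    have "t = t'" if "t \<in> ?bad T" "t' \<in> ?bad T" for t t'
    proof (rule ccontr)
      assume "t \<noteq> t'"
      \<comment> \<open>The update changes only the corner of the bordered matrix, so
        \<open>b e\<close> and \<open>c e\<close> are continued by zero on the border.\<close>
      let ?b = "case_sum (b e) (\<lambda>_. 0)" and ?c = "case_sum (c e) (\<lambda>_. 0)"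
      have fin: "finite (I <+> (E - T))" "finite (J <+> T)"
        using assms insert.hyps T by (auto intro: finite_subset)
      have upd: "rank_le (I <+> (E - T)) (J <+> T)
          (\<lambda>x y. bordered f b c x y + of_real s * ?b x * ?c y) r" if "s \<in> ?bad T" for s
        using that by (auto elim!: rank_le_cong)
      have "rank_le (I <+> (E - T)) (insert None (Some ` (J <+> T)))
            (\<lambda>x y. case y of None \<Rightarrow> ?b x | Some y \<Rightarrow> bordered f b c x y) r
          \<or> rank_le (insert None (Some ` (I <+> (E - T)))) (J <+> T)
            (\<lambda>x y. case x of None \<Rightarrow> ?c y | Some x \<Rightarrow> bordered f b c x y) r"
        by (rule rank_one_update[OF fin upd[OF that(1)] upd[OF that(2)]]) (use \<open>t \<noteq> t'\<close> in simp)
      then show False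
      proof
        assume "rank_le (I <+> (E - T)) (insert None (Some ` (J <+> T)))
            (\<lambda>x y. case y of None \<Rightarrow> ?b x | Some y \<Rightarrow> bordered f b c x y) r"
        then have "rank_le (I <+> (insert e E - insert e T)) (J <+> insert e T) (bordered f b c) r"
          by (rule rank_le_rel[where R = "(=)" and
                S = "\<lambda>y y'. y' = (if y = Inr e then None else Some y)"])
            (use insert.hyps T in \<open>auto split: if_splits sum.splits simp: bordered_def\<close>)
        with insert.prems[of "insert e T"] T show False by auto
      next
        assume "rank_le (insert None (Some ` (I <+> (E - T)))) (J <+> T)
            (\<lambda>x y. case x of None \<Rightarrow> ?c y | Some x \<Rightarrow> bordered f b c x y) r"
        then have "rank_le (I <+> (insert e E - T)) (J <+> T) (bordered f b c) r"
          by (rule rank_le_rel[where S = "(=)" and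
                R = "\<lambda>y y'. y' = (if y = Inr e then None else Some y)"])
            (use insert.hyps T in \<open>auto split: if_splits sum.splits simp: bordered_def\<close>)
        with insert.prems[of T] T show False by auto
      qed
    qed
    then show ?thesis
      by (metis (no_types, lifting) finite.emptyI finite_insert finite_subset insertCI subsetI subset_singletonD)
  qed
  then have "finite (\<Union>T\<in>Pow E. ?bad T)" using insert.hyps by blast
  then obtain t where t: "t \<notin> (\<Union>T\<in>Pow E. ?bad T)"
    using infinite_UNIV_char_0 ex_new_if_finite by blast
  then obtain s where "\<not> rank_le I J (\<lambda>i j. ?g t i j + (\<Sum>e\<in>E. of_real (s e) * b e i * c e j)) r"
    using insert.IH[of "?g t"] by blast
  moreover have "(\<Sum>e'\<in>E. of_real ((s(e := t)) e') * b e' i * c e' j) = (\<Sum>e\<in>E. of_real (s e) * b e i * c e j)" for i j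
    using insert.hyps by (intro sum.cong) auto
  ultimately have "\<not> rank_le I J (\<lambda>i j. f i j +
      (\<Sum>e'\<in>insert e E. of_real ((s(e := t)) e') * b e' i * c e' j)) r"
    using insert.hyps by (simp add: add.assoc)
  then show ?case by blast
qed

section \<open>From scalar gains to gain matrices\<close>

text \<open>Each entry of the gain matrix of agent \<open>i\<close> is a scalar channel
  \<open>(i, k, l)\<close> with column \<open>b (i, k)\<close> and row \<open>c (i, l)\<close>. A
  set of scalar channels need not come from a set of agents, but its border always contains the
  border belonging to one.\<close>

lemma multi_channel_feedback:
  fixes f :: "'i \<Rightarrow> 'j \<Rightarrow> complex" and b :: "nat \<times> nat \<Rightarrow> 'i \<Rightarrow> complex" and c :: "nat \<times> nat \<Rightarrow> 'j \<Rightarrow> complex"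
  assumes "finite I" "finite J"
    and no: "\<And>s. s \<subseteq> {0..<m} \<Longrightarrow>
      \<not> rank_le (I <+> Sigma ({0..<m} - s) (\<lambda>i. {..<q i})) (J <+> Sigma s (\<lambda>i. {..<p i})) (bordered f b c) r"
  shows "\<exists>t :: nat \<Rightarrow> nat \<Rightarrow> nat \<Rightarrow> real. \<not> rank_le I J
      (\<lambda>x y. f x y + (\<Sum>i<m. \<Sum>k<p i. \<Sum>l<q i. of_real (t i k l) * b (i, k) x * c (i, l) y)) r"
proof -
  let ?E = "Sigma {..<m} (\<lambda>i. {..<p i} \<times> {..<q i})"
  let ?b = "\<lambda>(i, k, l). b (i, k)" and ?c = "\<lambda>(i, k, l :: nat). c (i, l)"
  have "\<exists>t :: nat \<times> nat \<times> nat \<Rightarrow> real. \<not> rank_le I J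
      (\<lambda>x y. f x y + (\<Sum>e\<in>?E. of_real (t e) * ?b e x * ?c e y)) r"
  proof (rule scalar_channels)
    fix T assume T: "T \<subseteq> ?E"
    \<comment> \<open>Agent \<open>i\<close> joins \<open>s\<close> when \<open>T\<close> holds a
      copy of each of its columns. Otherwise some column \<open>k\<close> has no copy in
      \<open>T\<close>, so all \<open>(i, k, l)\<close> lie outside \<open>T\<close> and supply
      every row of agent \<open>i\<close>.\<close>
    define s where "s = {i. i < m \<and> (\<forall>k<p i. \<exists>l. (i, k, l) \<in> T)}"
    have s: "s \<subseteq> {0..<m}" by (auto simp: s_def)
    show "\<not> rank_le (I <+> (?E - T)) (J <+> T) (bordered f ?b ?c) r"
    proof
      assume "rank_le (I <+> (?E - T)) (J <+> T) (bordered f ?b ?c) r"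
      then have "rank_le (I <+> Sigma ({0..<m} - s) (\<lambda>i. {..<q i})) (J <+> Sigma s (\<lambda>i. {..<p i})) (bordered f b c) r"
      proof (rule rank_le_rel[where R = "\<lambda>x x'. case x of Inl i \<Rightarrow> x' = Inl i | Inr (i, l) \<Rightarrow> \<exists>k. x' = Inr (i, k, l)"
              and S = "\<lambda>x x'. case x of Inl i \<Rightarrow> x' = Inl i | Inr (i, k) \<Rightarrow> \<exists>l. x' = Inr (i, k, l)"], goal_cases)
        case (1 x)
        show ?case
        proof (cases x)
          case (Inr il)
          then obtain i l where il: "x = Inr (i, l)" by (cases il) auto
          with 1 have "i < m" "i \<notin> s" "l < q i" by auto
          then obtain k where "k < p i" "\<forall>l. (i, k, l) \<notin> T" by (auto simp: s_def)
          with il \<open>i < m\<close> \<open>l < q i\<close> have "Inr (i, k, l) \<in> I <+> (?E - T)" by auto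
          with il show ?thesis by auto
        qed (use 1 in auto)
      next
        case (2 x)
        then show ?case by (auto simp: s_def split: sum.splits) blast
      next
        case (3 i i' j j')
        then show ?case by (auto split: sum.splits prod.splits)
      qed
      with no[OF s] show False by blast
    qed
  qed (use assms in auto)
  then obtain t :: "nat \<times> nat \<times> nat \<Rightarrow> real" where
    t: "\<not> rank_le I J (\<lambda>x y. f x y + (\<Sum>e\<in>?E. of_real (t e) * ?b e x * ?c e y)) r" by blast
  have "(\<Sum>e\<in>?E. of_real (t e) * ?b e x * ?c e y)
     = (\<Sum>i<m. \<Sum>k<p i. \<Sum>l<q i. of_real (t (i, k, l)) * b (i, k) x * c (i, l) y)" for x y
    by (simp add: sum.Sigma split_def)
  with t show ?thesis by (intro exI[of _ "\<lambda>i k l. t (i, k, l)"]) simp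
qed

lemma sum_mult_swap:
  fixes g :: "'e \<Rightarrow> 'a::comm_ring"
  shows "(\<Sum>e\<in>S. g e * (\<Sum>h\<in>K. a h * w e h)) = (\<Sum>h\<in>K. a h * (\<Sum>e\<in>S. g e * w e h))"
  unfolding sum_distrib_left by (subst sum.swap) (simp add: mult.left_commute)

lemma sum_mult_swap2:
  fixes g :: "'e \<Rightarrow> 'a::comm_ring"
  shows "(\<Sum>e\<in>S. \<Sum>e'\<in>S'. g e * g' e' * (\<Sum>h\<in>K. w e h * w' e' h))
    = (\<Sum>h\<in>K. (\<Sum>e\<in>S. g e * w e h) * (\<Sum>e'\<in>S'. g' e' * w' e' h))"
proof -
  have "(\<Sum>e\<in>S. \<Sum>e'\<in>S'. g e * g' e' * (\<Sum>h\<in>K. w e h * w' e' h))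
      = (\<Sum>e\<in>S. g e * (\<Sum>e'\<in>S'. g' e' * (\<Sum>h\<in>K. w e h * w' e' h)))"
    by (simp add: sum_distrib_left mult.assoc)
  also have "\<dots> = (\<Sum>e\<in>S. g e * (\<Sum>h\<in>K. w e h * (\<Sum>e'\<in>S'. g' e' * w' e' h)))"
    by (intro sum.cong refl arg_cong2[where f = times] sum_mult_swap)
  also have "\<dots> = (\<Sum>e\<in>S. g e * (\<Sum>h\<in>K. (\<Sum>e'\<in>S'. g' e' * w' e' h) * w e h))"
    by (intro sum.cong refl arg_cong2[where f = times] mult.commute)
  also have "\<dots> = (\<Sum>h\<in>K. (\<Sum>e'\<in>S'. g' e' * w' e' h) * (\<Sum>e\<in>S. g e * w e h))"
    by (rule sum_mult_swap)
  also have "\<dots> = (\<Sum>h\<in>K. (\<Sum>e\<in>S. g e * w e h) * (\<Sum>e'\<in>S'. g' e' * w' e' h))"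
    by (intro sum.cong refl mult.commute)
  finally show ?thesis .
qed

text \<open>For every gain the feedback is absorbed into the factors of the bordered matrix:
  channels outside \<open>s\<close> alter the left factor through their border rows, channels in
  \<open>s\<close> the right factor through their border columns. The cross terms pair a border row
  with a border column, and that corner is zero.\<close>

lemma multi_channel_rank_le:
  fixes f :: "'i \<Rightarrow> 'j \<Rightarrow> 'a::field" and m :: nat and p q :: "nat \<Rightarrow> nat"
  assumes "s \<subseteq> {0..<m}"
    and "rank_le (I <+> Sigma ({0..<m} - s) (\<lambda>i. {..<q i})) (J <+> Sigma s (\<lambda>i. {..<p i})) (bordered f b c) r"
  shows "rank_le I J (\<lambda>x y. f x y + (\<Sum>i<m. \<Sum>k<p i. \<Sum>l<q i. t i k l * b (i, k) x * c (i, l) y)) r"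
proof -
  obtain u v where uv: "\<And>x y. x \<in> I <+> Sigma ({0..<m} - s) (\<lambda>i. {..<q i}) \<Longrightarrow> y \<in> J <+> Sigma s (\<lambda>i. {..<p i}) \<Longrightarrow>
     bordered f b c x y = (\<Sum>k<r. u x k * v y k)"
    using rank_leE[OF assms(2)] by blast
  let ?S = "Sigma s (\<lambda>i. {..<p i} \<times> {..<q i})" and ?S' = "Sigma ({0..<m} - s) (\<lambda>i. {..<p i} \<times> {..<q i})"
  define u' where "u' x h = u (Inl x) h + (\<Sum>(i, k, l)\<in>?S'. t i k l * b (i, k) x * u (Inr (i, l)) h)" for x h
  define v' where "v' y h = v (Inl y) h + (\<Sum>(i, k, l)\<in>?S. t i k l * c (i, l) y * v (Inr (i, k)) h)" for y h
  have fin: "finite s" by (rule finite_subset[OF assms(1)]) simp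
  show ?thesis
  proof (rule rank_leI[of "{..<r}" _ _ _ _ u' v'], goal_cases)
    case (3 x y)
    let ?U = "\<lambda>z w. \<Sum>h<r. u z h * v w h"
    have "(\<Sum>h<r. u' x h * v' y h) = ?U (Inl x) (Inl y)
        + (\<Sum>(i, k, l)\<in>?S. t i k l * c (i, l) y * ?U (Inl x) (Inr (i, k)))
        + (\<Sum>(i, k, l)\<in>?S'. t i k l * b (i, k) x * ?U (Inr (i, l)) (Inl y))
        + (\<Sum>(i, k, l)\<in>?S'. \<Sum>(i', k', l')\<in>?S. t i k l * b (i, k) x * (t i' k' l' * c (i', l') y) * ?U (Inr (i, l)) (Inr (i', k')))"
      (is "_ = ?A + ?B + ?C + ?D")
    proof -
      have B: "?B = (\<Sum>h<r. u (Inl x) h * (\<Sum>(i, k, l)\<in>?S. t i k l * c (i, l) y * v (Inr (i, k)) h))"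
        unfolding split_def by (rule sum_mult_swap)
      have C: "?C = (\<Sum>h<r. v (Inl y) h * (\<Sum>(i, k, l)\<in>?S'. t i k l * b (i, k) x * u (Inr (i, l)) h))"
        unfolding split_def by (rule trans[OF _ sum_mult_swap]) (intro sum.cong refl arg_cong2[where f = times] mult.commute)
      have D: "?D = (\<Sum>h<r. (\<Sum>(i, k, l)\<in>?S'. t i k l * b (i, k) x * u (Inr (i, l)) h) *
            (\<Sum>(i, k, l)\<in>?S. t i k l * c (i, l) y * v (Inr (i, k)) h))"
        unfolding split_def by (rule sum_mult_swap2)
      show ?thesis unfolding B C D u'_def v'_def by (simp add: algebra_simps sum.distrib)
    qed
    also have "?A = f x y" using 3 by (simp add: uv[OF InlI InlI, symmetric])
    also have "?B = (\<Sum>(i, k, l)\<in>?S. t i k l * b (i, k) x * c (i, l) y)"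
      by (intro sum.cong refl) (use 3 in \<open>auto simp: uv[OF InlI InrI[OF SigmaI], symmetric]\<close>)
    also have "?C = (\<Sum>(i, k, l)\<in>?S'. t i k l * b (i, k) x * c (i, l) y)"
      by (intro sum.cong refl) (use 3 in \<open>auto simp: uv[OF InrI[OF SigmaI] InlI, symmetric]\<close>)
    also have "?D = 0"
      by (intro sum.neutral ballI)
        (auto simp: uv[OF InrI[OF SigmaI] InrI[OF SigmaI], symmetric] intro!: sum.neutral)
    also have "f x y + (\<Sum>(i, k, l)\<in>?S. t i k l * b (i, k) x * c (i, l) y)
       + (\<Sum>(i, k, l)\<in>?S'. t i k l * b (i, k) x * c (i, l) y) + 0
      = f x y + (\<Sum>(i, k, l)\<in>Sigma {..<m} (\<lambda>i. {..<p i} \<times> {..<q i}). t i k l * b (i, k) x * c (i, l) y)"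
    proof -
      have "Sigma {..<m} (\<lambda>i. {..<p i} \<times> {..<q i}) = ?S \<union> ?S'" using assms(1) by (auto simp: subset_iff)
      then show ?thesis using fin
        by (subst \<open>_ = ?S \<union> ?S'\<close>, subst sum.union_disjoint) auto
    qed
    also have "\<dots> = f x y + (\<Sum>i<m. \<Sum>k<p i. \<Sum>l<q i. t i k l * b (i, k) x * c (i, l) y)"
      by (simp add: sum.Sigma split_def)
    finally show ?case by simp
  qed auto
qed

section \<open>Ranks and fixed spectra of matrices\<close>

text \<open>A maximal independent set \<open>S\<close> of columns mediates. Its elements are the
  intermediate indices of a factorisation; conversely they form an array with trivial kernel that
  inherits the bound, so \<open>card S\<close> is at most \<open>r\<close>.\<close>

lemma (in vec_space) rank_le_iff:
  assumes A: "A \<in> carrier_mat n nc"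
  shows "rank A \<le> r \<longleftrightarrow> rank_le {..<n} {..<nc} (\<lambda>i j. A $$ (i, j)) r"
proof -
  let ?P = "\<lambda>T. T \<subseteq> set (cols A) \<and> lin_indpt T"
  have cols: "set (cols A) \<subseteq> carrier_vec n" using cols_dim A by blast
  have "lin_indpt {}" by (auto simp: lin_dep_def)
  then obtain S where S: "finite S" "maximal S ?P"
    using maximal_exists_superset[of "set (cols A)" ?P "{}"] by auto
  then have r: "rank A = card S" using rank_card_indpt[OF A] by simp
  have SA: "S \<subseteq> set (cols A)" and li: "lin_indpt S" using S(2) by (auto simp: maximal_def)
  have Sc: "S \<subseteq> carrier_vec n" using SA cols by blast
  show ?thesis
  proof
    assume le: "rank A \<le> r"
    have "\<exists>a. x = lincomb a S" if x: "x \<in> set (cols A)" for x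
    proof -
      have "x \<in> span S"
      proof (cases "x \<in> S")
        case True
        then show ?thesis using span_mem Sc by blast
      next
        case False
        have "lin_dep (insert x S)"
        proof (rule ccontr)
          assume "\<not> lin_dep (insert x S)"
          then have "?P (insert x S)" using SA x by blast
          then have "insert x S = S" using S(2) unfolding maximal_def by blast
          with False show False by blast
        qed
        then show ?thesis
          using lin_dep_iff_in_span[of S x] Sc li x cols False by auto
      qed
      then show ?thesis using finite_in_span[OF S(1)] Sc by auto
    qed
    then obtain a where a: "\<And>x. x \<in> set (cols A) \<Longrightarrow> x = lincomb (a x) S" by metis
    show "rank_le {..<n} {..<nc} (\<lambda>i j. A $$ (i, j)) r"
    proof (rule rank_leI[of S _ _ _ _ "\<lambda>i x. x $ i" "\<lambda>j. a (col A j)"], goal_cases)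
      case (3 i j)
      then have "col A j \<in> set (cols A)" using A by (simp add: cols_def)
      then have "col A j $ i = lincomb (a (col A j)) S $ i" using a by metis
      then show ?case using 3 A lincomb_index[of i S] Sc by (simp add: mult.commute)
    qed (use S le r in auto)
  next
    assume le: "rank_le {..<n} {..<nc} (\<lambda>i j. A $$ (i, j)) r"
    have "rank_le {..<n} S (\<lambda>i x. x $ i) r"
      by (rule rank_le_rel[OF le, where R = "\<lambda>i i'. i = i' \<and> i < n" and S = "\<lambda>x j. x = col A j \<and> j < nc"])
        (use SA A in \<open>fastforce simp: cols_def\<close>)+
    then have "card S \<le> r"
    proof (rule trivial_kernel_rank)
      fix x v assume x: "\<And>i. i \<in> {..<n} \<Longrightarrow> (\<Sum>j\<in>S. j $ i * x j) = 0" and v: "v \<in> S"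
      have "lincomb x S = 0\<^sub>v n"
      proof (rule eq_vecI)
        fix i assume "i < dim_vec (0\<^sub>v n)"
        then show "lincomb x S $ i = 0\<^sub>v n $ i"
          using x[of i] lincomb_index[of i S x] Sc by (simp add: mult.commute)
      qed (simp add: lincomb_dim S Sc)
      then show "x v = 0"
        using not_lindepD[OF li S(1) order_refl, of x] v by auto
    qed (use S in auto)
    with r show "rank A \<le> r" by simp
  qed
qed

text \<open>Existence of a matching column is all that \<open>rank_le_rel\<close> asks for, so exact
  positions inside the concatenation stay open.\<close>

lemma hcat_cols:
  assumes "\<forall>M\<in>set Ms. dim_row M = r"
  shows "dim_row (hcat r Ms) = r"
    and "e < dim_col (hcat r Ms) \<Longrightarrow> \<exists>M\<in>set Ms. \<exists>k<dim_col M. \<forall>a<r. hcat r Ms $$ (a, e) = M $$ (a, k)"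
    and "M \<in> set Ms \<Longrightarrow> k < dim_col M \<Longrightarrow> \<exists>e<dim_col (hcat r Ms). \<forall>a<r. hcat r Ms $$ (a, e) = M $$ (a, k)"
  using assms
proof (induction Ms arbitrary: e)
  case Nil
  { case 1 show ?case by simp next case 2 then show ?case by simp next case 3 then show ?case by simp }
next
  case (Cons M' Ms)
  { case 1 then show ?case by simp
  next
    case 2
    have dr: "dim_row (hcat r Ms) = r" using Cons.IH(1) 2 by simp
    show ?case
    proof (cases "e < dim_col M'")
      case True
      then show ?thesis using 2 dr by (intro bexI[of _ M'] exI[of _ e]) auto
    next
      case False
      then have "e - dim_col M' < dim_col (hcat r Ms)" using 2 dr by (simp add: append_rows_def less_diff_conv2)
      then obtain M k where "M \<in> set Ms" "k < dim_col M" "\<forall>a<r. hcat r Ms $$ (a, e - dim_col M') = M $$ (a, k)"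
        using Cons.IH(2) 2 by (metis list.set_intros(2))
      then show ?thesis using 2 dr False by (intro bexI[of _ M] exI[of _ k]) auto
    qed
  next
    case 3
    have dr: "dim_row (hcat r Ms) = r" using Cons.IH(1) 3 by simp
    show ?case
    proof (cases "M = M'")
      case True
      then show ?thesis using 3 dr by (intro exI[of _ k]) auto
    next
      case False
      then obtain e where "e < dim_col (hcat r Ms)" "\<forall>a<r. hcat r Ms $$ (a, e) = M $$ (a, k)"
        using Cons.IH(3) 3 by auto
      then show ?thesis using 3 dr by (intro exI[of _ "dim_col M' + e"]) auto
    qed }
qed

lemma vcat_rows:
  assumes "\<forall>M\<in>set Ms. dim_col M = c"
  shows "dim_col (vcat c Ms) = c"
    and "e < dim_row (vcat c Ms) \<Longrightarrow> \<exists>M\<in>set Ms. \<exists>k<dim_row M. \<forall>a<c. vcat c Ms $$ (e, a) = M $$ (k, a)"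
    and "M \<in> set Ms \<Longrightarrow> k < dim_row M \<Longrightarrow> \<exists>e<dim_row (vcat c Ms). \<forall>a<c. vcat c Ms $$ (e, a) = M $$ (k, a)"
  using assms
proof (induction Ms arbitrary: e)
  case Nil
  { case 1 show ?case by simp next case 2 then show ?case by simp next case 3 then show ?case by simp }
next
  case (Cons M' Ms)
  { case 1 then show ?case by (simp add: append_rows_def)
  next
    case 2
    have dr: "dim_col (vcat c Ms) = c" using Cons.IH(1) 2 by simp
    show ?case
    proof (cases "e < dim_row M'")
      case True
      then show ?thesis using 2 dr by (intro bexI[of _ M'] exI[of _ e]) (auto simp: append_rows_def)
    next
      case False
      then have "e - dim_row M' < dim_row (vcat c Ms)" using 2 dr by (simp add: append_rows_def less_diff_conv2)
      then obtain M k where "M \<in> set Ms" "k < dim_row M" "\<forall>a<c. vcat c Ms $$ (e - dim_row M', a) = M $$ (k, a)"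
        using Cons.IH(2) 2 by (metis list.set_intros(2))
      then show ?thesis using 2 dr False by (intro bexI[of _ M] exI[of _ k]) (auto simp: append_rows_def)
    qed
  next
    case 3
    have dr: "dim_col (vcat c Ms) = c" using Cons.IH(1) 3 by simp
    show ?case
    proof (cases "M = M'")
      case True
      then show ?thesis using 3 dr by (intro exI[of _ k]) (auto simp: append_rows_def)
    next
      case False
      then obtain e where "e < dim_row (vcat c Ms)" "\<forall>a<c. vcat c Ms $$ (e, a) = M $$ (k, a)"
        using Cons.IH(3) 3 by auto
      then show ?thesis using 3 dr by (intro exI[of _ "dim_row M' + e"]) (auto simp: append_rows_def)
    qed }
qed

definition pencil ::
    "complex \<Rightarrow> real mat \<Rightarrow> (nat \<Rightarrow> real mat) \<Rightarrow> (nat \<Rightarrow> real mat) \<Rightarrow> nat + nat \<times> nat \<Rightarrow> nat + nat \<times> nat \<Rightarrow> complex" where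
  "pencil lam A B C = bordered (\<lambda>a b. lam * of_bool (a = b) - of_real (A $$ (a, b)))
     (\<lambda>(i, k) a. of_real (B i $$ (a, k))) (\<lambda>(i, l) b. of_real (C i $$ (l, b)))"

definition pencil_rank_le where
  "pencil_rank_le m n p q lam A B C s r \<longleftrightarrow>
     rank_le ({..<n} <+> Sigma ({0..<m} - s) (\<lambda>i. {..<q i})) ({..<n} <+> Sigma s (\<lambda>i. {..<p i})) (pencil lam A B C) r"

lemma rank_test_le_iff:
  assumes A: "A \<in> carrier_mat n n"
    and B: "\<forall>i<m. B i \<in> carrier_mat n (p i)"
    and C: "\<forall>i<m. C i \<in> carrier_mat (q i) n"
    and s: "s \<subseteq> {0..<m}"
  shows "rank_test n A B C m s lam \<le> r \<longleftrightarrow> pencil_rank_le m n p q lam A B C s r"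
proof -
  define Bs where "Bs = B_sub n B s"
  define Cs where "Cs = C_sub n C ({0..<m} - s)"
  define M where "M = four_block_mat (lam \<cdot>\<^sub>m 1\<^sub>m n - cplx A) (cplx Bs) (cplx Cs) (0\<^sub>m (dim_row Cs) (dim_col Bs))"
  have fs: "finite s" by (rule finite_subset[OF s]) simp
  have Bd: "\<forall>X\<in>set (map B (sorted_list_of_set s)). dim_row X = n"
    using B s fs by fastforce
  have Cd: "\<forall>X\<in>set (map C (sorted_list_of_set ({0..<m} - s))). dim_col X = n"
    using C by auto
  have Bs: "dim_row Bs = n"
    using hcat_cols(1)[OF Bd] by (simp add: Bs_def B_sub_def)
  have Cs: "dim_col Cs = n"
    using vcat_rows(1)[OF Cd] by (simp add: Cs_def C_sub_def)
  have M: "M \<in> carrier_mat (n + dim_row Cs) (n + dim_col Bs)"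
    unfolding M_def by (rule carrier_matI) (use A in \<open>simp_all add: cplx_def\<close>)
  have "rank_test n A B C m s lam = vec_space.rank (n + dim_row Cs) M"
    using A by (simp add: rank_test_def Let_def crank_def M_def Bs_def Cs_def cplx_def)
  then have "rank_test n A B C m s lam \<le> r \<longleftrightarrow> rank_le {..<n + dim_row Cs} {..<n + dim_col Bs} (\<lambda>i j. M $$ (i, j)) r"
    by (simp add: vec_space.rank_le_iff[OF M])
  also have "\<dots> \<longleftrightarrow> pencil_rank_le m n p q lam A B C s r"
  proof -
    \<comment> \<open>A border position and a name are related when their entries agree; one
      position may match several names.\<close>
    define R where "R x y = (case y of Inl a \<Rightarrow> x = a \<and> a < n
      | Inr (i, l) \<Rightarrow> n \<le> x \<and> x < n + dim_row Cs \<and> l < q i \<and> i < m \<and> (\<forall>b<n. Cs $$ (x - n, b) = C i $$ (l, b)))" for x y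
    define S where "S x y = (case y of Inl a \<Rightarrow> x = a \<and> a < n
      | Inr (i, k) \<Rightarrow> n \<le> x \<and> x < n + dim_col Bs \<and> k < p i \<and> i < m \<and> (\<forall>b<n. Bs $$ (b, x - n) = B i $$ (b, k)))" for x y
    have eq: "M $$ (x, x') = pencil lam A B C y y'" if "R x y" "S x' y'" for x y x' y'
      using that A Bs Cs B C
      by (auto simp: R_def S_def M_def pencil_def cplx_def split: sum.splits)
    have R1: "\<exists>y\<in>{..<n} <+> Sigma ({0..<m} - s) (\<lambda>i. {..<q i}). R x y" if "x \<in> {..<n + dim_row Cs}" for x
    proof (cases "x < n")
      case True
      then show ?thesis by (auto simp: R_def intro!: bexI[of _ "Inl x"])
    next
      case False
      then have "x - n < dim_row (vcat n (map C (sorted_list_of_set ({0..<m} - s))))"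
        using that by (auto simp: Cs_def C_sub_def)
      from vcat_rows(2)[OF Cd this] obtain i l where "i \<in> {0..<m} - s" "l < dim_row (C i)"
        "\<forall>b<n. Cs $$ (x - n, b) = C i $$ (l, b)" by (auto simp: Cs_def C_sub_def)
      then show ?thesis using False that C by (intro bexI[of _ "Inr (i, l)"]) (auto simp: R_def)
    qed
    have S1: "\<exists>y\<in>{..<n} <+> Sigma s (\<lambda>i. {..<p i}). S x y" if "x \<in> {..<n + dim_col Bs}" for x
    proof (cases "x < n")
      case True
      then show ?thesis by (auto simp: S_def intro!: bexI[of _ "Inl x"])
    next
      case False
      then have "x - n < dim_col (hcat n (map B (sorted_list_of_set s)))"
        using that by (auto simp: Bs_def B_sub_def)
      from hcat_cols(2)[OF Bd this] obtain i l where "i \<in> s" "l < dim_col (B i)"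
        "\<forall>b<n. Bs $$ (b, x - n) = B i $$ (b, l)" using fs by (auto simp: Bs_def B_sub_def)
      moreover from this have "i < m" using s by auto
      moreover from this have "l < p i" using \<open>l < dim_col (B i)\<close> B by (metis carrier_matD(2))
      ultimately show ?thesis using False that by (intro bexI[of _ "Inr (i, l)"]) (auto simp: S_def)
    qed
    have R2: "\<exists>x\<in>{..<n + dim_row Cs}. R x y" if yin: "y \<in> {..<n} <+> Sigma ({0..<m} - s) (\<lambda>i. {..<q i})" for y
    proof (cases y)
      case (Inl a)
      with that show ?thesis by (auto simp: R_def)
    next
      case (Inr il)
      then obtain i l where y: "y = Inr (i, l)" "i < m" "i \<notin> s" "l < q i" using yin by auto
      then have "C i \<in> set (map C (sorted_list_of_set ({0..<m} - s)))" "l < dim_row (C i)" using C by auto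
      from vcat_rows(3)[OF Cd this] obtain e where "e < dim_row Cs" "\<forall>a<n. Cs $$ (e, a) = C i $$ (l, a)"
        by (auto simp: Cs_def C_sub_def)
      then show ?thesis using y by (intro bexI[of _ "n + e"]) (auto simp: R_def)
    qed
    have S2: "\<exists>x\<in>{..<n + dim_col Bs}. S x y" if yin: "y \<in> {..<n} <+> Sigma s (\<lambda>i. {..<p i})" for y
    proof (cases y)
      case (Inl a)
      with that show ?thesis by (auto simp: S_def)
    next
      case (Inr il)
      then obtain i l where y: "y = Inr (i, l)" "i < m" "i \<in> s" "l < p i" using yin s by auto
      then have "B i \<in> set (map B (sorted_list_of_set s))" "l < dim_col (B i)" using B fs by auto
      from hcat_cols(3)[OF Bd this] obtain e where "e < dim_col Bs" "\<forall>a<n. Bs $$ (a, e) = B i $$ (a, l)"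
        by (auto simp: Bs_def B_sub_def)
      then show ?thesis using y by (intro bexI[of _ "n + e"]) (auto simp: S_def)
    qed
    show ?thesis unfolding pencil_rank_le_def
    proof
      assume "rank_le {..<n + dim_row Cs} {..<n + dim_col Bs} (\<lambda>i j. M $$ (i, j)) r"
      then show "rank_le ({..<n} <+> Sigma ({0..<m} - s) (\<lambda>i. {..<q i})) ({..<n} <+> Sigma s (\<lambda>i. {..<p i})) (pencil lam A B C) r"
        by (rule rank_le_rel[where R = "\<lambda>y x. R x y" and S = "\<lambda>y x. S x y"]) (use R2 S2 eq in auto)
    next
      assume "rank_le ({..<n} <+> Sigma ({0..<m} - s) (\<lambda>i. {..<q i})) ({..<n} <+> Sigma s (\<lambda>i. {..<p i})) (pencil lam A B C) r"
      then show "rank_le {..<n + dim_row Cs} {..<n + dim_col Bs} (\<lambda>i j. M $$ (i, j)) r"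
        by (rule rank_le_rel[where R = R and S = S]) (use R1 S1 eq in auto)
    qed
  qed
  finally show ?thesis .
qed

section \<open>Closed loops and the fixed spectrum\<close>

lemma eigenvalue_iff_rank_le:
  assumes "M \<in> carrier_mat n n"
  shows "eigenvalue (cplx M) lam \<longleftrightarrow>
    n > 0 \<and> rank_le {..<n} {..<n} (\<lambda>a b. lam * of_bool (a = b) - of_real (M $$ (a, b))) (n - 1)"
proof (cases "n = 0")
  case True
  then show ?thesis using eigenvalue_imp_nonzero_dim[of "cplx M" n lam] assms by (auto simp: cplx_def)
next
  case False
  let ?f = "\<lambda>a b. lam * of_bool (a = b) - complex_of_real (M $$ (a, b))"
  have sum: "(\<Sum>b<n. ?f a b * x b) = lam * x a - (\<Sum>b<n. of_real (M $$ (a, b)) * x b)" if "a < n" for a x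
  proof -
    have "(\<Sum>b<n. lam * of_bool (a = b) * x b) = (\<Sum>b<n. if b = a then lam * x a else 0)"
      by (intro sum.cong) auto
    then show ?thesis using that by (simp add: left_diff_distrib sum_subtractf)
  qed
  have mv: "(cplx M *\<^sub>v v) $ a = (\<Sum>b<n. of_real (M $$ (a, b)) * v $ b)" if "a < n" "v \<in> carrier_vec n" for a v
    using that assms by (auto simp: cplx_def scalar_prod_def lessThan_atLeast0 intro!: sum.cong)
  have dims: "dim_row (cplx M) = n" using assms by (auto simp: cplx_def)
  have "eigenvalue (cplx M) lam \<longleftrightarrow>
      (\<exists>x. (\<exists>i\<in>{..<n}. x i \<noteq> 0) \<and> (\<forall>i\<in>{..<n}. (\<Sum>j<n. ?f i j * x j) = 0))"
  proof
    assume "eigenvalue (cplx M) lam"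
    then obtain v where v: "v \<in> carrier_vec n" "v \<noteq> 0\<^sub>v n" "cplx M *\<^sub>v v = lam \<cdot>\<^sub>v v"
      unfolding eigenvalue_def eigenvector_def dims by blast
    have "\<exists>i<n. v $ i \<noteq> 0" using v by (auto intro!: eq_vecI)
    moreover have "(\<Sum>j<n. ?f i j * v $ j) = 0" if "i < n" for i
      using sum[OF that, of "($) v"] mv[OF that v(1)] v that by simp
    ultimately show "\<exists>x. (\<exists>i\<in>{..<n}. x i \<noteq> 0) \<and> (\<forall>i\<in>{..<n}. (\<Sum>j<n. ?f i j * x j) = 0)"
      by (intro exI[of _ "($) v"]) auto
  next
    assume "\<exists>x. (\<exists>i\<in>{..<n}. x i \<noteq> 0) \<and> (\<forall>i\<in>{..<n}. (\<Sum>j<n. ?f i j * x j) = 0)"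
    then obtain x l where x: "l < n" "x l \<noteq> 0" "\<And>i. i < n \<Longrightarrow> (\<Sum>j<n. ?f i j * x j) = 0" by auto
    define v where "v = vec n x"
    have v: "v \<in> carrier_vec n" by (simp add: v_def)
    have "v $ l \<noteq> 0" using x by (simp add: v_def)
    then have "v \<noteq> 0\<^sub>v n" using x(1) by auto
    moreover have "cplx M *\<^sub>v v = lam \<cdot>\<^sub>v v"
    proof (rule eq_vecI)
      fix a assume "a < dim_vec (lam \<cdot>\<^sub>v v)"
      then have a: "a < n" using v by simp
      have "(\<Sum>b<n. of_real (M $$ (a, b)) * v $ b) = (\<Sum>b<n. of_real (M $$ (a, b)) * x b)"
        by (intro sum.cong) (auto simp: v_def)
      then show "(cplx M *\<^sub>v v) $ a = (lam \<cdot>\<^sub>v v) $ a"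
        using sum[OF a, of x] x(3)[OF a] mv[OF a v] a by (simp add: v_def)
    qed (use dims v in auto)
    ultimately show "eigenvalue (cplx M) lam"
      using v unfolding eigenvalue_def eigenvector_def dims by blast
  qed
  also have "\<dots> \<longleftrightarrow> rank_le {..<n} {..<n} ?f (n - 1)"
    by (subst singular_iff_rank_le) (use False in auto)
  finally show ?thesis using False by simp
qed

lemma mult_mat_entry:
  assumes "X \<in> carrier_mat n k" "Y \<in> carrier_mat k n'" "a < n" "b < n'"
  shows "(X * Y) $$ (a, b) = (\<Sum>l<k. X $$ (a, l) * Y $$ (l, b))"
  using assms by (auto simp: scalar_prod_def lessThan_atLeast0 intro!: sum.cong)

lemma feedback_entries:
  fixes A :: "'a::comm_ring_1 mat"
  assumes A: "A \<in> carrier_mat n n"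
    and BFC: "\<forall>i<m. B i \<in> carrier_mat n (p i)" "\<forall>i<m. F i \<in> carrier_mat (p i) (q i)"
      "\<forall>i<m. C i \<in> carrier_mat (q i) n"
  shows "foldl (\<lambda>M i. M + B i * F i * C i) A [0..<m] \<in> carrier_mat n n \<and>
    (\<forall>a<n. \<forall>b<n. foldl (\<lambda>M i. M + B i * F i * C i) A [0..<m] $$ (a, b)
       = A $$ (a, b) + (\<Sum>i<m. \<Sum>k<p i. \<Sum>l<q i. F i $$ (k, l) * B i $$ (a, k) * C i $$ (l, b)))"
  using BFC
proof (induction m)
  case 0
  with A show ?case by simp
next
  case (Suc m)
  have BFC: "B m \<in> carrier_mat n (p m)" "F m \<in> carrier_mat (p m) (q m)" "C m \<in> carrier_mat (q m) n"
    using Suc.prems by auto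
  define X where "X = B m * F m * C m"
  have "X $$ (a, b) = (\<Sum>k<p m. \<Sum>l<q m. F m $$ (k, l) * B m $$ (a, k) * C m $$ (l, b))"
    if "a < n" "b < n" for a b
  proof -
    have "(B m * F m * C m) $$ (a, b) = (\<Sum>l<q m. (\<Sum>k<p m. B m $$ (a, k) * F m $$ (k, l)) * C m $$ (l, b))"
      using that BFC mult_mat_entry[of "B m * F m" n "q m" "C m" n a b]
      by (simp add: mult_mat_entry[of "B m" n "p m" "F m" "q m"] del: assoc_mult_mat index_mult_mat)
    also have "\<dots> = (\<Sum>k<p m. \<Sum>l<q m. F m $$ (k, l) * B m $$ (a, k) * C m $$ (l, b))"
      unfolding sum_distrib_right by (subst sum.swap) (simp add: mult_ac)
    finally show ?thesis unfolding X_def .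
  qed
  moreover have "X \<in> carrier_mat n n" using BFC by (auto simp: X_def)
  ultimately show ?case using Suc by (simp add: X_def[symmetric] add.assoc)
qed

text \<open>The two halves are \<open>multi_channel_rank_le\<close> and
  \<open>multi_channel_feedback\<close>. The conjunct \<open>n > 0\<close> matters: for
  \<open>n = 0\<close> the truncated \<open>n - 1\<close> is 0 and the rank bound holds, but there
  is no eigenvalue.\<close>

lemma fixed_spectrum_iff:
  assumes A: "A \<in> carrier_mat n n"
    and B: "\<forall>i<m. B i \<in> carrier_mat n (p i)"
    and C: "\<forall>i<m. C i \<in> carrier_mat (q i) n"
  shows "lam \<in> fixed_spectrum A B C m \<longleftrightarrow> n > 0 \<and> (\<exists>s\<subseteq>{0..<m}. pencil_rank_le m n p q lam A B C s (n - 1))"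
proof -
  let ?f = "\<lambda>a b. lam * of_bool (a = b) - of_real (A $$ (a, b))"
  let ?b = "\<lambda>(i, k) a. complex_of_real (B i $$ (a, k))" and ?c = "\<lambda>(i, l) b. complex_of_real (C i $$ (l, b))"
  let ?g = "\<lambda>t a b. ?f a b + (\<Sum>i<m. \<Sum>k<p i. \<Sum>l<q i. of_real (t i k l) * ?b (i, k) a * ?c (i, l) b)"
  \<comment> \<open>The closed loop is subtracted from \<open>lam\<close> times the identity, so the
    gains enter the pencil with a minus sign.\<close>
  have cl: "eigenvalue (cplx (foldl (\<lambda>M i. M + B i * F i * C i) A [0..<m])) lam \<longleftrightarrow>
      n > 0 \<and> rank_le {..<n} {..<n} (?g (\<lambda>i k l. - F i $$ (k, l))) (n - 1)"
    if F: "\<forall>i<m. F i \<in> carrier_mat (p i) (q i)" for F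
  proof -
    let ?M = "foldl (\<lambda>M i. M + B i * F i * C i) A [0..<m]"
    have M: "?M \<in> carrier_mat n n" and ent: "\<And>a b. a < n \<Longrightarrow> b < n \<Longrightarrow> ?M $$ (a, b)
       = A $$ (a, b) + (\<Sum>i<m. \<Sum>k<p i. \<Sum>l<q i. F i $$ (k, l) * B i $$ (a, k) * C i $$ (l, b))"
      using feedback_entries[OF A B F C] by auto
    have eq: "lam * of_bool (a = b) - of_real (?M $$ (a, b)) = ?g (\<lambda>i k l. - F i $$ (k, l)) a b"
      if "a < n" "b < n" for a b
      unfolding ent[OF that] by (simp add: sum_negf)
    show ?thesis unfolding eigenvalue_iff_rank_le[OF M]
      by (intro conj_cong refl iffI; erule rank_le_cong) (simp_all add: eq)
  qed
  show ?thesis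
  proof
    assume "n > 0 \<and> (\<exists>s\<subseteq>{0..<m}. pencil_rank_le m n p q lam A B C s (n - 1))"
    then obtain s where s: "n > 0" "s \<subseteq> {0..<m}" "pencil_rank_le m n p q lam A B C s (n - 1)" by blast
    show "lam \<in> fixed_spectrum A B C m"
      unfolding fixed_spectrum_def
    proof (clarify)
      fix F :: "nat \<Rightarrow> real mat"
      assume "\<forall>i<m. F i \<in> carrier_mat (dim_col (B i)) (dim_row (C i))"
      then have F: "\<forall>i<m. F i \<in> carrier_mat (p i) (q i)" using B C by (metis carrier_matD)
      show "eigenvalue (cplx (foldl (\<lambda>M i. M + B i * F i * C i) A [0..<m])) lam"
        unfolding cl[OF F]
        by (intro conjI s(1) multi_channel_rank_le[OF s(2) s(3)[unfolded pencil_rank_le_def pencil_def]])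
    qed
  next
    assume lam: "lam \<in> fixed_spectrum A B C m"
    have carr: "\<forall>i<m. F i \<in> carrier_mat (p i) (q i) \<Longrightarrow> \<forall>i<m. F i \<in> carrier_mat (dim_col (B i)) (dim_row (C i))" for F
      using B C by (metis carrier_matD)
    have ev: "n > 0 \<and> rank_le {..<n} {..<n} (?g (\<lambda>i k l. - F i $$ (k, l))) (n - 1)"
      if "\<forall>i<m. F i \<in> carrier_mat (p i) (q i)" for F
      using lam carr[OF that] cl[OF that] unfolding fixed_spectrum_def by blast
    have n: "n > 0" using ev[of "\<lambda>i. 0\<^sub>m (p i) (q i)"] by simp
    have "\<exists>s\<subseteq>{0..<m}. pencil_rank_le m n p q lam A B C s (n - 1)"
    proof (rule ccontr)
      assume "\<not> ?thesis"
      then have "\<exists>t :: nat \<Rightarrow> nat \<Rightarrow> nat \<Rightarrow> real. \<not> rank_le {..<n} {..<n} (?g t) (n - 1)"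
        by (intro multi_channel_feedback) (auto simp: pencil_rank_le_def pencil_def)
      then obtain t :: "nat \<Rightarrow> nat \<Rightarrow> nat \<Rightarrow> real" where t: "\<not> rank_le {..<n} {..<n} (?g t) (n - 1)" by blast
      define F where "F i = mat (p i) (q i) (\<lambda>(k, l). - t i k l)" for i
      have "rank_le {..<n} {..<n} (?g (\<lambda>i k l. - F i $$ (k, l))) (n - 1)"
        using ev[of F] by (simp add: F_def)
      moreover have "?g (\<lambda>i k l. - F i $$ (k, l)) = ?g t"
        by (intro ext arg_cong2[where f = "(+)"] sum.cong refl) (auto simp: F_def)
      ultimately show False using t by simp
    qed
    with n show "n > 0 \<and> (\<exists>s\<subseteq>{0..<m}. pencil_rank_le m n p q lam A B C s (n - 1))" by blast
  qed
qed

section \<open>Entries of the extended system\<close>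

lemma partial_sum_less:
  fixes w :: "nat \<Rightarrow> nat"
  assumes "k < m" "a < w k"
  shows "(\<Sum>l<k. w l) + a < (\<Sum>l<m. w l)"
proof -
  have "(\<Sum>l<k. w l) + a < (\<Sum>l<Suc k. w l)" using assms by simp
  also have "\<dots> \<le> (\<Sum>l<m. w l)" using assms by (intro sum_mono2) auto
  finally show ?thesis .
qed

lemma partial_sum_inj:
  fixes w :: "nat \<Rightarrow> nat"
  assumes "a < w k" "a' < w k'" "(\<Sum>l<k. w l) + a = (\<Sum>l<k'. w l) + a'"
  shows "k = k' \<and> a = a'"
  using partial_sum_less[of k k' a w] partial_sum_less[of k' k a' w] assms
  by (cases k k' rule: linorder_cases) auto

lemma partial_sum_surj:
  fixes w :: "nat \<Rightarrow> nat"
  assumes "r < (\<Sum>l<m. w l)"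
  shows "\<exists>k<m. \<exists>a<w k. r = (\<Sum>l<k. w l) + a"
  using assms
proof (induction m)
  case (Suc m)
  show ?case
  proof (cases "r < (\<Sum>l<m. w l)")
    case True
    then show ?thesis using Suc.IH less_Suc_eq by blast
  next
    case False
    then show ?thesis using Suc.prems
      by (intro exI[of _ m] conjI exI[of _ "r - (\<Sum>l<m. w l)"]) auto
  qed
qed simp

text \<open>\<open>block_diag\<close> recurses at the head of the list while
  \<open>[0..<Suc m]\<close> grows at its end, so the induction splits off block 0 and shifts the
  others. This is why \<open>f\<close> and \<open>w\<close> are arbitrary.\<close>

lemma block_diag_entries:
  fixes f :: "nat \<Rightarrow> 'a::zero mat"
  assumes "\<forall>k<m. f k \<in> carrier_mat (w k) (w k)"
  shows "block_diag (map f [0..<m]) \<in> carrier_mat (\<Sum>k<m. w k) (\<Sum>k<m. w k)"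
    and "k < m \<Longrightarrow> k' < m \<Longrightarrow> a < w k \<Longrightarrow> b < w k' \<Longrightarrow>
      block_diag (map f [0..<m]) $$ ((\<Sum>l<k. w l) + a, (\<Sum>l<k'. w l) + b) = (if k = k' then f k $$ (a, b) else 0)"
  using assms
proof (induction m arbitrary: f w k k')
  case 0
  { case 1 then show ?case by simp next case 2 then show ?case by simp }
next
  case (Suc m)
  have eq: "map f [0..<Suc m] = f 0 # map (\<lambda>k. f (Suc k)) [0..<m]"
    for f :: "nat \<Rightarrow> 'a mat" by (simp add: upt_conv_Cons map_Suc_upt[symmetric] del: upt_Suc)
  have carr: "block_diag (map (\<lambda>k. f (Suc k)) [0..<m]) \<in> carrier_mat (\<Sum>k<m. w (Suc k)) (\<Sum>k<m. w (Suc k))"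
    if "\<forall>k<Suc m. f k \<in> carrier_mat (w k) (w k)" for f :: "nat \<Rightarrow> 'a mat" and w
    by (rule Suc.IH(1)) (use that in auto)
  { case 1
    have "f 0 \<in> carrier_mat (w 0) (w 0)" using 1 by auto
    then show ?case using carr[OF 1] unfolding eq by (simp add: sum.lessThan_Suc_shift del: sum.lessThan_Suc)
  next
    case 2
    have f0: "f 0 \<in> carrier_mat (w 0) (w 0)" using 2 by auto
    have IH: "block_diag (map (\<lambda>k. f (Suc k)) [0..<m]) $$ ((\<Sum>l<j. w (Suc l)) + a, (\<Sum>l<j'. w (Suc l)) + b)
        = (if j = j' then f (Suc j) $$ (a, b) else 0)"
      if "j < m" "j' < m" "a < w (Suc j)" "b < w (Suc j')" for j j'
      by (rule Suc.IH(2)[of j j' "\<lambda>k. w (Suc k)"]) (use 2 that in auto)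
    have bd: "(\<Sum>l<j. w (Suc l)) + x < (\<Sum>l<m. w (Suc l))" if "j < m" "x < w (Suc j)" for j x
      using partial_sum_less[of j m x "\<lambda>l. w (Suc l)"] that by simp
    show ?case
      using 2(1-4) f0 carr[OF 2(5)] IH bd unfolding eq
      by (cases k; cases k') (auto simp: sum.lessThan_Suc_shift add.assoc simp del: sum.lessThan_Suc)
  }
qed

text \<open>Position of component $c$ of $z_k(t-\delta)$ within the controller part of the state.\<close>

definition memidx :: "(nat \<Rightarrow> nat) \<Rightarrow> (nat \<Rightarrow> nat) \<Rightarrow> nat \<Rightarrow> nat \<Rightarrow> nat \<Rightarrow> nat" where
  "memidx dm nn k \<delta> c = offs dm nn k + \<delta> * nn k + c"

lemma mult_add_less:
  fixes w :: nat
  assumes "\<delta> \<le> d" "c < w"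
  shows "\<delta> * w + c < (d + 1) * w"
proof -
  have "\<delta> * w + c < Suc \<delta> * w" using assms by simp
  also have "\<dots> \<le> (d + 1) * w" using assms by (intro mult_le_mono1) auto
  finally show ?thesis .
qed

lemma mult_add_inj:
  fixes w :: nat
  assumes "\<delta> * w + c = \<delta>' * w + c'" "c < w" "c' < w"
  shows "\<delta> = \<delta>' \<and> c = c'"
proof -
  have "(\<delta> * w + c) div w = (\<delta>' * w + c') div w" using assms(1) by simp
  then have "\<delta> = \<delta>'" using assms(2,3) by simp
  with assms(1) show ?thesis by simp
qed

lemma memidx_less: "k < m \<Longrightarrow> \<delta> \<le> dm k \<Longrightarrow> c < nn k \<Longrightarrow> memidx dm nn k \<delta> c < Nz m dm nn"
  unfolding memidx_def offs_def Nz_def add.assoc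
  by (rule partial_sum_less[where w = "\<lambda>l. (dm l + 1) * nn l"]) (assumption, rule mult_add_less)

lemma memidx_inj:
  assumes "\<delta> \<le> dm k" "c < nn k" "\<delta>' \<le> dm k'" "c' < nn k'"
  shows "memidx dm nn k \<delta> c = memidx dm nn k' \<delta>' c' \<longleftrightarrow> k = k' \<and> \<delta> = \<delta>' \<and> c = c'"
proof
  assume eq: "memidx dm nn k \<delta> c = memidx dm nn k' \<delta>' c'"
  have "k = k' \<and> \<delta> * nn k + c = \<delta>' * nn k' + c'"
    by (rule partial_sum_inj[where w = "\<lambda>l. (dm l + 1) * nn l"])
      (use eq mult_add_less assms in \<open>auto simp: memidx_def offs_def add.assoc\<close>)
  then show "k = k' \<and> \<delta> = \<delta>' \<and> c = c'" using assms mult_add_inj by metis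
qed simp

lemma memidx_surj:
  assumes "r < Nz m dm nn"
  obtains k \<delta> c where "k < m" "\<delta> \<le> dm k" "c < nn k" "r = memidx dm nn k \<delta> c"
proof -
  obtain k a where k: "k < m" "a < (dm k + 1) * nn k" "r = offs dm nn k + a"
    using partial_sum_surj[of r "\<lambda>l. (dm l + 1) * nn l" m] assms unfolding Nz_def offs_def by blast
  \<comment> \<open>A chain of width zero contains no position, so dividing by \<open>nn k\<close>
    is safe.\<close>
  have "nn k > 0" using k(2) by (cases "nn k") auto
  then have "a div nn k \<le> dm k" "a mod nn k < nn k" "a = a div nn k * nn k + a mod nn k"
    using k(2) less_mult_imp_div_less[of a "dm k + 1" "nn k"] by auto
  then show ?thesis using that k unfolding memidx_def by (metis add.assoc)
qed

section \<open>Entries of \<open>A_hat\<close>, \<open>B_hat\<close> and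
  \<open>C_hat\<close>\<close>

lemma A_hat_carrier:
  assumes "A \<in> carrier_mat n n"
  shows "A_hat A m dm nn \<in> carrier_mat (n + Nz m dm nn) (n + Nz m dm nn)"
  using assms block_diag_entries(1)[of m "\<lambda>k. shift_blk (dm k) (nn k)" "\<lambda>k. (dm k + 1) * nn k"]
  by (auto simp: A_hat_def Nz_def shift_blk_def)

lemma A_hat_entries:
  assumes A: "A \<in> carrier_mat n n"
  shows "a < n \<Longrightarrow> b < n \<Longrightarrow> A_hat A m dm nn $$ (a, b) = A $$ (a, b)"
    and "a < n \<Longrightarrow> r < Nz m dm nn \<Longrightarrow> A_hat A m dm nn $$ (a, n + r) = 0"
    and "a < n \<Longrightarrow> r < Nz m dm nn \<Longrightarrow> A_hat A m dm nn $$ (n + r, a) = 0"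
    and "k < m \<Longrightarrow> \<delta> \<le> dm k \<Longrightarrow> c < nn k \<Longrightarrow> k' < m \<Longrightarrow> \<delta>' \<le> dm k' \<Longrightarrow> c' < nn k' \<Longrightarrow>
      A_hat A m dm nn $$ (n + memidx dm nn k \<delta> c, n + memidx dm nn k' \<delta>' c') = of_bool (k = k' \<and> c = c' \<and> \<delta> = Suc \<delta>')"
proof -
  let ?f = "\<lambda>k. shift_blk (dm k) (nn k)"
  let ?D = "block_diag (map ?f [0..<m])"
  have f: "?f k \<in> carrier_mat ((dm k + 1) * nn k) ((dm k + 1) * nn k)" for k
    by (simp add: shift_blk_def)
  have D: "?D \<in> carrier_mat (Nz m dm nn) (Nz m dm nn)"
    unfolding Nz_def by (rule block_diag_entries(1)) (use f in blast)
  show "a < n \<Longrightarrow> b < n \<Longrightarrow> A_hat A m dm nn $$ (a, b) = A $$ (a, b)"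
    "a < n \<Longrightarrow> r < Nz m dm nn \<Longrightarrow> A_hat A m dm nn $$ (a, n + r) = 0"
    "a < n \<Longrightarrow> r < Nz m dm nn \<Longrightarrow> A_hat A m dm nn $$ (n + r, a) = 0"
    using A D by (auto simp: A_hat_def)
  assume b: "k < m" "\<delta> \<le> dm k" "c < nn k" "k' < m" "\<delta>' \<le> dm k'" "c' < nn k'"
  have lt: "\<delta> * nn k + c < (dm k + 1) * nn k" "\<delta>' * nn k' + c' < (dm k' + 1) * nn k'"
    using mult_add_less b by blast+
  have "A_hat A m dm nn $$ (n + memidx dm nn k \<delta> c, n + memidx dm nn k' \<delta>' c')
      = ?D $$ (memidx dm nn k \<delta> c, memidx dm nn k' \<delta>' c')"
    using A D memidx_less[of k m \<delta> dm c nn] memidx_less[of k' m \<delta>' dm c' nn] b by (auto simp: A_hat_def)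
  also have "\<dots> = (if k = k' then ?f k $$ (\<delta> * nn k + c, \<delta>' * nn k' + c') else 0)"
    unfolding memidx_def offs_def add.assoc
    by (rule block_diag_entries(2)) (use b lt f in auto)
  also have "\<dots> = of_bool (k = k' \<and> c = c' \<and> \<delta> = Suc \<delta>')"
  proof (cases "k = k'")
    case True
    have "\<delta> * nn k + c = \<delta>' * nn k + c' + nn k \<longleftrightarrow> \<delta> = Suc \<delta>' \<and> c = c'"
      using mult_add_inj[of \<delta> "nn k" c "Suc \<delta>'" c'] b True by auto
    with True lt show ?thesis by (auto simp: shift_blk_def)
  qed simp
  finally show "A_hat A m dm nn $$ (n + memidx dm nn k \<delta> c, n + memidx dm nn k' \<delta>' c') = of_bool (k = k' \<and> c = c' \<and> \<delta> = Suc \<delta>')" .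
qed

lemma B_hat_carrier:
  "B i \<in> carrier_mat n (p i) \<Longrightarrow> B_hat n B m dm nn i \<in> carrier_mat (n + Nz m dm nn) (p i + nn i)"
  by (auto simp: B_hat_def H_def)

lemma B_hat_entries:
  assumes "B i \<in> carrier_mat n (p i)"
  shows "a < n \<Longrightarrow> e < p i \<Longrightarrow> B_hat n B m dm nn i $$ (a, e) = B i $$ (a, e)"
    and "a < n \<Longrightarrow> c < nn i \<Longrightarrow> B_hat n B m dm nn i $$ (a, p i + c) = 0"
    and "r < Nz m dm nn \<Longrightarrow> e < p i \<Longrightarrow> B_hat n B m dm nn i $$ (n + r, e) = 0"
    and "r < Nz m dm nn \<Longrightarrow> c < nn i \<Longrightarrow> B_hat n B m dm nn i $$ (n + r, p i + c) = of_bool (r = memidx dm nn i 0 c)"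
  using assms by (auto simp: B_hat_def H_def memidx_def)

text \<open>Row $e$ of $M$ reads off component $c$ of the most delayed state of agent $k$.\<close>

definition mem_row :: "nat \<Rightarrow> nat \<Rightarrow> (nat \<Rightarrow> nat) \<Rightarrow> (nat \<Rightarrow> nat) \<Rightarrow> real mat \<Rightarrow> nat \<Rightarrow> nat \<Rightarrow> nat \<Rightarrow> bool" where
  "mem_row n nz dm nn M e k c \<longleftrightarrow> (\<forall>b<n. M $$ (e, b) = 0) \<and>
     (\<forall>r<nz. M $$ (e, n + r) = of_bool (r = memidx dm nn k (dm k) c))"

lemma C_hat_rows:
  assumes C: "C i \<in> carrier_mat (q i) n" and fin: "finite (N i)"
  shows "dim_col (C_hat n C m N dm nn i) = n + Nz m dm nn"
    and "dim_row (C_hat n C m N dm nn i) \<ge> q i"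
    and "l < q i \<Longrightarrow> b < n \<Longrightarrow> C_hat n C m N dm nn i $$ (l, b) = C i $$ (l, b)"
    and "l < q i \<Longrightarrow> r < Nz m dm nn \<Longrightarrow> C_hat n C m N dm nn i $$ (l, n + r) = 0"
    and "q i \<le> e \<Longrightarrow> e < dim_row (C_hat n C m N dm nn i) \<Longrightarrow>
      \<exists>k\<in>N i. \<exists>c<nn k. mem_row n (Nz m dm nn) dm nn (C_hat n C m N dm nn i) e k c"
    and "k \<in> N i \<Longrightarrow> c < nn k \<Longrightarrow>
      \<exists>e<dim_row (C_hat n C m N dm nn i). mem_row n (Nz m dm nn) dm nn (C_hat n C m N dm nn i) e k c"
proof -
  define Ms where "Ms = map (\<lambda>j. transpose_mat (H m dm nn j (dm j))) (sorted_list_of_set (N i))"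
  define G where "G = vcat (Nz m dm nn) Ms"
  have Ch: "C_hat n C m N dm nn i = four_block_mat (C i) (0\<^sub>m (dim_row (C i)) (Nz m dm nn)) (0\<^sub>m (dim_row G) n) G"
    by (simp add: C_hat_def Let_def G_def Ms_def)
  have dc: "\<forall>M\<in>set Ms. dim_col M = Nz m dm nn" by (auto simp: Ms_def H_def)
  have Gc: "dim_col G = Nz m dm nn" unfolding G_def by (rule vcat_rows(1)[OF dc])
  show "dim_col (C_hat n C m N dm nn i) = n + Nz m dm nn" "dim_row (C_hat n C m N dm nn i) \<ge> q i"
    using C Gc by (auto simp: Ch)
  show "l < q i \<Longrightarrow> b < n \<Longrightarrow> C_hat n C m N dm nn i $$ (l, b) = C i $$ (l, b)"
    "l < q i \<Longrightarrow> r < Nz m dm nn \<Longrightarrow> C_hat n C m N dm nn i $$ (l, n + r) = 0"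
    using C Gc by (auto simp: Ch)
  have row: "mem_row n (Nz m dm nn) dm nn (C_hat n C m N dm nn i) (q i + g) k c"
    if "g < dim_row G" "c < nn k" "\<forall>a<Nz m dm nn. G $$ (g, a) = transpose_mat (H m dm nn k (dm k)) $$ (c, a)" for g k c
    using that C Gc by (auto simp: mem_row_def Ch H_def memidx_def)
  show "\<exists>k\<in>N i. \<exists>c<nn k. mem_row n (Nz m dm nn) dm nn (C_hat n C m N dm nn i) e k c"
    if e: "q i \<le> e" "e < dim_row (C_hat n C m N dm nn i)"
  proof -
    have g: "e - q i < dim_row G" using e C by (auto simp: Ch)
    from vcat_rows(2)[OF dc g[unfolded G_def]] obtain k c where "k \<in> N i" "c < nn k"
      "\<forall>a<Nz m dm nn. G $$ (e - q i, a) = transpose_mat (H m dm nn k (dm k)) $$ (c, a)"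
      using fin by (auto simp: Ms_def G_def H_def)
    with row[OF g] e show ?thesis by auto
  qed
  show "\<exists>e<dim_row (C_hat n C m N dm nn i). mem_row n (Nz m dm nn) dm nn (C_hat n C m N dm nn i) e k c"
    if k: "k \<in> N i" "c < nn k"
  proof -
    have "transpose_mat (H m dm nn k (dm k)) \<in> set Ms" "c < dim_row (transpose_mat (H m dm nn k (dm k)))"
      using k fin by (auto simp: Ms_def H_def)
    from vcat_rows(3)[OF dc this] obtain g where g: "g < dim_row G"
      "\<forall>a<Nz m dm nn. G $$ (g, a) = transpose_mat (H m dm nn k (dm k)) $$ (c, a)"
      unfolding G_def by blast
    from row[OF g(1) k(2) g(2)] show ?thesis using g C by (intro exI[of _ "q i + g"]) (auto simp: Ch)
  qed
qed

section \<open>The extended system\<close>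

text \<open>Names for the rows and columns of the pencil of the extended system: \<open>MemSt k \<delta> c\<close> is
  component $c$ of $z_k(t-\delta)$, and \<open>MemPort k c\<close> is a component of $v_k$ as a column and of
  the measured $z_k(t-d_k)$ as a row, however many agents measure it.\<close>

datatype port_index = PlantSt nat | PlantPort nat nat | MemSt nat nat nat | MemPort nat nat

locale extended_system =
  fixes n m :: nat and A :: "real mat" and B C :: "nat \<Rightarrow> real mat" and p q :: "nat \<Rightarrow> nat"
    and N :: "nat \<Rightarrow> nat set" and dm nn :: "nat \<Rightarrow> nat" and lam :: complex
  assumes A: "A \<in> carrier_mat n n"
    and B: "\<forall>i<m. B i \<in> carrier_mat n (p i)"
    and C: "\<forall>i<m. C i \<in> carrier_mat (q i) n"
    and N: "\<forall>i<m. i \<in> N i \<and> N i \<subseteq> {0..<m}"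
begin

text \<open>One array serves all sets \<open>s\<close>, which enter only through the rows and
  columns selected. Plant and memory are decoupled in it, and so are different chains.\<close>

fun ext :: "port_index \<Rightarrow> port_index \<Rightarrow> complex" where
  "ext (PlantSt a) (PlantSt b) = lam * of_bool (a = b) - of_real (A $$ (a, b))"
| "ext (PlantSt a) (PlantPort i k) = of_real (B i $$ (a, k))"
| "ext (PlantPort i l) (PlantSt b) = of_real (C i $$ (l, b))"
| "ext (MemSt k \<delta> c) (MemSt k' \<delta>' c') =
     (if k = k' \<and> c = c' then lam * of_bool (\<delta> = \<delta>') - of_bool (\<delta> = Suc \<delta>') else 0)"
| "ext (MemSt k \<delta> c) (MemPort k' c') = of_bool (k = k' \<and> c = c' \<and> \<delta> = 0)"
| "ext (MemPort k c) (MemSt k' \<delta> c') = of_bool (k = k' \<and> c = c' \<and> \<delta> = dm k)"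
| "ext _ _ = 0"

definition plant_rows where
  "plant_rows s = PlantSt ` {..<n} \<union> case_prod PlantPort ` Sigma ({0..<m} - s) (\<lambda>i. {..<q i})"

definition plant_cols where
  "plant_cols s = PlantSt ` {..<n} \<union> case_prod PlantPort ` Sigma s (\<lambda>i. {..<p i})"

definition mem_states where
  "mem_states K = {MemSt k \<delta> c | k \<delta> c. k \<in> K \<and> \<delta> \<le> dm k \<and> c < nn k}"

definition mem_ports where
  "mem_ports K = {MemPort k c | k c. k \<in> K \<and> c < nn k}"

lemma plant_rank_le_iff:
  "rank_le (plant_rows s) (plant_cols s) ext r \<longleftrightarrow> pencil_rank_le m n p q lam A B C s r"
proof -
  define R where "R x y = (case y of Inl a \<Rightarrow> x = PlantSt a | Inr (i, l) \<Rightarrow> x = PlantPort i l)" for x and y :: "nat + nat \<times> nat"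
  have eq: "ext x x' = pencil lam A B C y y'" if "R x y" "R x' y'" for x x' y y'
    using that by (auto simp: R_def pencil_def split: sum.splits prod.splits)
  show ?thesis unfolding pencil_rank_le_def
  proof
    assume "rank_le (plant_rows s) (plant_cols s) ext r"
    then show "rank_le ({..<n} <+> Sigma ({0..<m} - s) (\<lambda>i. {..<q i})) ({..<n} <+> Sigma s (\<lambda>i. {..<p i})) (pencil lam A B C) r"
      by (rule rank_le_rel[where R = "\<lambda>y x. R x y" and S = "\<lambda>y x. R x y"])
        (auto simp: plant_rows_def plant_cols_def eq, auto simp: R_def)
  next
    assume "rank_le ({..<n} <+> Sigma ({0..<m} - s) (\<lambda>i. {..<q i})) ({..<n} <+> Sigma s (\<lambda>i. {..<p i})) (pencil lam A B C) r"
    then show "rank_le (plant_rows s) (plant_cols s) ext r"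
      by (rule rank_le_rel[where R = R and S = R])
        (auto simp: plant_rows_def plant_cols_def eq, (force simp: R_def)+)
  qed
qed

section \<open>Matching matrix positions with names\<close>

definition ext_rows where
  "ext_rows s = plant_rows s \<union> mem_states {..<m} \<union> mem_ports (N_set N ({0..<m} - s))"

definition ext_cols where
  "ext_cols s = plant_cols s \<union> mem_states {..<m} \<union> mem_ports s"

text \<open>A \<open>MemPort\<close> is related to every row of every agent that reads the
  component, so one name stands for all repeated measurements.\<close>

fun row_rel :: "nat + nat \<times> nat \<Rightarrow> port_index \<Rightarrow> bool" where
  "row_rel (Inl x) (PlantSt a) \<longleftrightarrow> x = a \<and> a < n"
| "row_rel (Inl x) (MemSt k \<delta> c) \<longleftrightarrow> x = n + memidx dm nn k \<delta> c \<and> k < m \<and> \<delta> \<le> dm k \<and> c < nn k"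
| "row_rel (Inr (i, e)) (PlantPort i' l) \<longleftrightarrow> i = i' \<and> e = l \<and> i < m \<and> l < q i"
| "row_rel (Inr (i, e)) (MemPort k c) \<longleftrightarrow> i < m \<and> k < m \<and> c < nn k \<and>
     mem_row n (Nz m dm nn) dm nn (C_hat n C m N dm nn i) e k c"
| "row_rel _ _ \<longleftrightarrow> False"

fun col_rel :: "nat + nat \<times> nat \<Rightarrow> port_index \<Rightarrow> bool" where
  "col_rel (Inl x) (PlantSt a) \<longleftrightarrow> x = a \<and> a < n"
| "col_rel (Inl x) (MemSt k \<delta> c) \<longleftrightarrow> x = n + memidx dm nn k \<delta> c \<and> k < m \<and> \<delta> \<le> dm k \<and> c < nn k"
| "col_rel (Inr (i, e)) (PlantPort i' k) \<longleftrightarrow> i = i' \<and> e = k \<and> i < m \<and> k < p i"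
| "col_rel (Inr (i, e)) (MemPort k c) \<longleftrightarrow> i = k \<and> k < m \<and> c < nn k \<and> e = p i + c"
| "col_rel _ _ \<longleftrightarrow> False"

lemma finite_N: "i < m \<Longrightarrow> finite (N i)"
  using N finite_subset[of "N i" "{0..<m}"] by simp

lemma N_less: "i < m \<Longrightarrow> k \<in> N i \<Longrightarrow> k < m"
  by (meson N atLeastLessThan_iff subsetD)

lemma ext_entry:
  assumes "row_rel x x'" "col_rel y y'"
  shows "pencil lam (A_hat A m dm nn) (B_hat n B m dm nn) (C_hat n C m N dm nn) x y = ext x' y'"
proof -
  note Ah = A_hat_entries[OF A, where m = m and dm = dm and nn = nn]
  have Bi: "B i \<in> carrier_mat n (p i)" if "i < m" for i using B that by blast
  note Bh = B_hat_entries[where B = B and p = p and m = m and dm = dm and nn = nn, OF Bi]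
  have Ci: "C i \<in> carrier_mat (q i) n" if "i < m" for i using C that by blast
  note Ch = C_hat_rows(3,4)[where C = C and q = q and N = N and m = m and dm = dm and nn = nn, OF Ci finite_N]
  show ?thesis
    using assms
    by (cases x' ; cases y' ; cases x; cases y)
      (auto simp: pencil_def Ah Bh Ch memidx_less memidx_inj mem_row_def)
qed

lemma row_rel_left:
  assumes s: "s \<subseteq> {0..<m}"
    and x: "x \<in> {..<n + Nz m dm nn} <+> Sigma ({0..<m} - s) (\<lambda>i. {..<dim_row (C_hat n C m N dm nn i)})"
  shows "\<exists>x'\<in>ext_rows s. row_rel x x'"
proof (cases x)
  case (Inl a)
  show ?thesis
  proof (cases "a < n")
    case True
    then show ?thesis using Inl by (intro bexI[of _ "PlantSt a"]) (auto simp: ext_rows_def plant_rows_def)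
  next
    case False
    then have "a - n < Nz m dm nn" using x Inl by auto
    then obtain k \<delta> c where "k < m" "\<delta> \<le> dm k" "c < nn k" "a - n = memidx dm nn k \<delta> c"
      by (rule memidx_surj)
    then show ?thesis using Inl False
      by (intro bexI[of _ "MemSt k \<delta> c"]) (auto simp: ext_rows_def mem_states_def)
  qed
next
  case (Inr ie)
  then obtain i e where ie: "x = Inr (i, e)" "i < m" "i \<notin> s" "e < dim_row (C_hat n C m N dm nn i)"
    using x by auto
  show ?thesis
  proof (cases "e < q i")
    case True
    then show ?thesis using ie
      by (intro bexI[of _ "PlantPort i e"]) (force simp: ext_rows_def plant_rows_def)+
  next
    case False
    have "C i \<in> carrier_mat (q i) n" using C ie by blast
    from C_hat_rows(5)[where C = C and q = q and N = N and m = m and dm = dm and nn = nn, OF this finite_N[OF ie(2)], of e]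
    obtain k c where k: "k \<in> N i" "c < nn k" "mem_row n (Nz m dm nn) dm nn (C_hat n C m N dm nn i) e k c"
      using False ie by auto
    then have "k < m" using N_less ie by blast
    moreover have "k \<in> N_set N ({0..<m} - s)" using k ie by (auto simp: N_set_def)
    ultimately show ?thesis using k ie
      by (intro bexI[of _ "MemPort k c"]) (auto simp: ext_rows_def mem_ports_def)
  qed
qed

lemma row_rel_right:
  assumes s: "s \<subseteq> {0..<m}" and x': "x' \<in> ext_rows s"
  shows "\<exists>x\<in>{..<n + Nz m dm nn} <+> Sigma ({0..<m} - s) (\<lambda>i. {..<dim_row (C_hat n C m N dm nn i)}). row_rel x x'"
proof (cases x')
  case (PlantSt a)
  then show ?thesis using x'
    by (intro bexI[of _ "Inl a"]) (auto simp: ext_rows_def plant_rows_def mem_states_def mem_ports_def)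
next
  case (PlantPort i l)
  then have i: "i < m" "i \<notin> s" "l < q i"
    using x' by (auto simp: ext_rows_def plant_rows_def mem_states_def mem_ports_def)
  have "C i \<in> carrier_mat (q i) n" using C i by blast
  from C_hat_rows(2)[where C = C and q = q and N = N and m = m and dm = dm and nn = nn, OF this finite_N[OF i(1)]]
  show ?thesis using i PlantPort by (intro bexI[of _ "Inr (i, l)"]) auto
next
  case (MemSt k \<delta> c)
  then have k: "k < m" "\<delta> \<le> dm k" "c < nn k"
    using x' by (auto simp: ext_rows_def plant_rows_def mem_states_def mem_ports_def)
  then show ?thesis using memidx_less[of k m \<delta> dm c nn] MemSt
    by (intro bexI[of _ "Inl (n + memidx dm nn k \<delta> c)"]) auto
next
  case (MemPort k c)
  then obtain i where i: "i < m" "i \<notin> s" "k \<in> N i" "c < nn k"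
    using x' by (auto simp: ext_rows_def plant_rows_def mem_states_def mem_ports_def N_set_def)
  have "C i \<in> carrier_mat (q i) n" using C i by blast
  from C_hat_rows(6)[where C = C and q = q and N = N and m = m and dm = dm and nn = nn, OF this finite_N[OF i(1)] i(3,4)]
  obtain e where "e < dim_row (C_hat n C m N dm nn i)" "mem_row n (Nz m dm nn) dm nn (C_hat n C m N dm nn i) e k c"
    by blast
  moreover have "k < m" using N_less i by blast
  ultimately show ?thesis using i MemPort by (intro bexI[of _ "Inr (i, e)"]) auto
qed

lemma col_rel_left:
  assumes s: "s \<subseteq> {0..<m}"
    and x: "x \<in> {..<n + Nz m dm nn} <+> Sigma s (\<lambda>i. {..<p i + nn i})"
  shows "\<exists>x'\<in>ext_cols s. col_rel x x'"
proof (cases x)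
  case (Inl a)
  show ?thesis
  proof (cases "a < n")
    case True
    then show ?thesis using Inl by (intro bexI[of _ "PlantSt a"]) (auto simp: ext_cols_def plant_cols_def)
  next
    case False
    then have "a - n < Nz m dm nn" using x Inl by auto
    then obtain k \<delta> c where "k < m" "\<delta> \<le> dm k" "c < nn k" "a - n = memidx dm nn k \<delta> c"
      by (rule memidx_surj)
    then show ?thesis using Inl False
      by (intro bexI[of _ "MemSt k \<delta> c"]) (auto simp: ext_cols_def mem_states_def)
  qed
next
  case (Inr ie)
  then obtain i e where ie: "x = Inr (i, e)" "i < m" "i \<in> s" "e < p i + nn i"
    using x s by auto
  show ?thesis
  proof (cases "e < p i")
    case True
    then show ?thesis using ie
      by (intro bexI[of _ "PlantPort i e"]) (force simp: ext_cols_def plant_cols_def)+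
  next
    case False
    then show ?thesis using ie
      by (intro bexI[of _ "MemPort i (e - p i)"]) (auto simp: ext_cols_def mem_ports_def)
  qed
qed

lemma col_rel_right:
  assumes s: "s \<subseteq> {0..<m}" and x': "x' \<in> ext_cols s"
  shows "\<exists>x\<in>{..<n + Nz m dm nn} <+> Sigma s (\<lambda>i. {..<p i + nn i}). col_rel x x'"
proof (cases x')
  case (PlantSt a)
  then show ?thesis using x'
    by (intro bexI[of _ "Inl a"]) (auto simp: ext_cols_def plant_cols_def mem_states_def mem_ports_def)
next
  case (PlantPort i l)
  then have "i \<in> s" "l < p i"
    using x' by (auto simp: ext_cols_def plant_cols_def mem_states_def mem_ports_def)
  then show ?thesis using s PlantPort by (intro bexI[of _ "Inr (i, l)"]) auto
next
  case (MemSt k \<delta> c)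
  then have k: "k < m" "\<delta> \<le> dm k" "c < nn k"
    using x' by (auto simp: ext_cols_def plant_cols_def mem_states_def mem_ports_def)
  then show ?thesis using memidx_less[of k m \<delta> dm c nn] MemSt
    by (intro bexI[of _ "Inl (n + memidx dm nn k \<delta> c)"]) auto
next
  case (MemPort k c)
  then have "k \<in> s" "c < nn k"
    using x' by (auto simp: ext_cols_def plant_cols_def mem_states_def mem_ports_def)
  then show ?thesis using s MemPort by (intro bexI[of _ "Inr (k, p k + c)"]) auto
qed

lemma ext_rank_le_iff:
  assumes s: "s \<subseteq> {0..<m}"
  shows "pencil_rank_le m (n + Nz m dm nn) (\<lambda>i. p i + nn i) (\<lambda>i. dim_row (C_hat n C m N dm nn i)) lam
      (A_hat A m dm nn) (B_hat n B m dm nn) (C_hat n C m N dm nn) s r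
    \<longleftrightarrow> rank_le (ext_rows s) (ext_cols s) ext r"
proof
  assume "pencil_rank_le m (n + Nz m dm nn) (\<lambda>i. p i + nn i) (\<lambda>i. dim_row (C_hat n C m N dm nn i)) lam
      (A_hat A m dm nn) (B_hat n B m dm nn) (C_hat n C m N dm nn) s r"
  then show "rank_le (ext_rows s) (ext_cols s) ext r"
    unfolding pencil_rank_le_def
    by (rule rank_le_rel[where R = "\<lambda>y x. row_rel x y" and S = "\<lambda>y x. col_rel x y"])
      (auto simp: ext_entry row_rel_right[OF s] col_rel_right[OF s])
next
  assume "rank_le (ext_rows s) (ext_cols s) ext r"
  then show "pencil_rank_le m (n + Nz m dm nn) (\<lambda>i. p i + nn i) (\<lambda>i. dim_row (C_hat n C m N dm nn i)) lam
      (A_hat A m dm nn) (B_hat n B m dm nn) (C_hat n C m N dm nn) s r"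
    unfolding pencil_rank_le_def
    by (rule rank_le_rel[where R = row_rel and S = col_rel])
      (auto simp: ext_entry row_rel_left[OF s] col_rel_left[OF s])
qed

section \<open>Rank contributed by the memory chains\<close>

lemma card_mem_states:
  assumes "finite K"
  shows "finite (mem_states K) \<and> card (mem_states K) = (\<Sum>k\<in>K. (dm k + 1) * nn k)"
proof -
  have eq: "mem_states K = (\<lambda>(k, \<delta>, c). MemSt k \<delta> c) ` Sigma K (\<lambda>k. {..dm k} \<times> {..<nn k})"
    by (force simp: mem_states_def)
  have "inj_on (\<lambda>(k, \<delta>, c). MemSt k \<delta> c) (Sigma K (\<lambda>k. {..dm k} \<times> {..<nn k}))"
    by (auto simp: inj_on_def)
  then show ?thesis unfolding eq using assms by (simp add: card_image)
qed

text \<open>A chain of an agent in \<open>s\<close> has no output row here, so its state rows cover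
  all its nonzero entries. A chain of an agent outside \<open>s\<close> has no input column, so its
  state columns do. Deleting these rows and columns, \<open>Nz\<close> in total, leaves only the
  plant.\<close>

lemma ext_rank_upper:
  assumes s: "s \<subseteq> {0..<m}" and disj: "N_set N ({0..<m} - s) \<inter> s = {}"
    and plant: "rank_le (plant_rows s) (plant_cols s) ext r"
  shows "rank_le (ext_rows s) (ext_cols s) ext (r + Nz m dm nn)"
proof -
  let ?t = "{0..<m} - s"
  have fin: "finite s" "finite ?t" using s finite_subset by auto
  have "rank_le (plant_rows s \<union> mem_states ?t \<union> mem_ports (N_set N ?t)) (plant_cols s \<union> mem_states s \<union> mem_ports s) ext r"
    by (rule rank_le_extend_zero[OF plant])
      (use disj in \<open>auto simp: plant_rows_def plant_cols_def mem_states_def mem_ports_def\<close>)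
  from rank_le_add_rows[OF _ rank_le_add_cols[OF _ this], of "mem_states s" "mem_states ?t"]
  have "rank_le (plant_rows s \<union> mem_states ?t \<union> mem_ports (N_set N ?t) \<union> mem_states s)
      (plant_cols s \<union> mem_states s \<union> mem_ports s \<union> mem_states ?t) ext
      (r + card (mem_states ?t) + card (mem_states s))"
    using card_mem_states fin by blast
  moreover have "card (mem_states ?t) + card (mem_states s) = Nz m dm nn"
    using card_mem_states fin s sum.subset_diff[of s "{..<m}" "\<lambda>k. (dm k + 1) * nn k"]
    by (simp add: Nz_def lessThan_atLeast0)
  moreover have "mem_states {..<m} \<subseteq> mem_states s \<union> mem_states ?t"
    by (auto simp: mem_states_def)
  ultimately show ?thesis
    unfolding ext_rows_def ext_cols_def by (auto simp: add.assoc elim!: rank_le_subset)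
qed

text \<open>Plant rows vanish in all memory columns, so triangular pivots inside the chains can be
  split off, and their number is subtracted from \<open>r\<close>.\<close>

lemma ext_rank_lower:
  assumes s: "s \<subseteq> {0..<m}" and r: "rank_le (ext_rows s) (ext_cols s) ext r"
  defines "e \<equiv> (\<Sum>k\<in>s \<inter> N_set N ({0..<m} - s). nn k)"
  shows "Nz m dm nn + e \<le> r \<and> rank_le (plant_rows s) (plant_cols s) ext (r - (Nz m dm nn + e))"
proof -
  let ?M = "N_set N ({0..<m} - s)"
  \<comment> \<open>Since \<open>k\<close> lies in \<open>N k\<close>, an agent outside
    \<open>s\<close> measures its own chain. So no chain lacks both its input and its
    output.\<close>
  have Ns: "k \<in> s \<or> k \<in> ?M" if "k < m" for k using N that by (auto simp: N_set_def)
  define lo hi where "lo k = (if k \<in> s then 0 else 1 :: nat)"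
    and "hi k = (if k \<in> ?M then dm k + 1 else dm k)" for k
  \<comment> \<open>Pivots: the entries -1 below the diagonal of each chain, plus the unit entry of its input (index 0)
    and of its output (index $d_k+1$) where these exist; they are triangular in the delay index.\<close>
  define P where "P = Sigma {..<m} (\<lambda>k. {lo k..hi k} \<times> {..<nn k})"
  \<comment> \<open>Pairing row \<open>\<delta>\<close> with column \<open>\<delta> - 1\<close> puts
    the entries -1 on the pivots. The entry \<open>lam\<close> of that column sits in the state row
    \<open>\<delta> - 1\<close>, of lower level, so \<open>lam = 0\<close> needs no separate
    case.\<close>
  let ?row = "\<lambda>(k, \<delta>, c). if \<delta> \<le> dm k then MemSt k \<delta> c else MemPort k c"
  let ?col = "\<lambda>(k, \<delta>, c). if \<delta> = 0 then MemPort k c else MemSt k (\<delta> - 1) c"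
  have "card P = (\<Sum>k<m. (Suc (hi k) - lo k) * nn k)"
    unfolding P_def by (simp add: card_cartesian_product)
  also have "\<dots> = (\<Sum>k<m. (dm k + 1) * nn k + (if k \<in> s \<inter> ?M then nn k else 0))"
    using Ns by (intro sum.cong) (auto simp: lo_def hi_def algebra_simps)
  also have "\<dots> = Nz m dm nn + e"
    using sum.inter_restrict[of "{..<m}" nn "s \<inter> ?M"] s
    by (simp add: sum.distrib Nz_def e_def Int_absorb1 le_infI1 lessThan_atLeast0)
  finally have card: "card P = Nz m dm nn + e" .
  have "card P \<le> r \<and> rank_le (plant_rows s) (plant_cols s) ext (r - card P)"
  proof (rule rank_le_triangular[where \<rho> = ?row and \<gamma> = ?col and lev = "\<lambda>(k, \<delta>, c). \<delta>"])
    show "finite P" by (simp add: P_def)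
    have "plant_rows s \<union> ?row ` P \<subseteq> ext_rows s"
      by (auto simp: ext_rows_def P_def mem_states_def mem_ports_def hi_def split: if_splits)
    moreover have "plant_cols s \<union> ?col ` P \<subseteq> ext_cols s"
      by (auto simp: ext_cols_def P_def mem_states_def mem_ports_def hi_def lo_def split: if_splits)
    ultimately show "rank_le (plant_rows s \<union> ?row ` P) (plant_cols s \<union> ?col ` P) ext r"
      by (rule rank_le_subset[OF r])
    show "ext (?row x) (?col x) \<noteq> 0" if "x \<in> P" for x
    proof -
      obtain k \<delta> c where "x = (k, \<delta>, c)" by (cases x)
      with that show ?thesis by (cases \<delta>) (auto simp: P_def hi_def split: if_splits)
    qed
    show "ext i (?col x) = 0" if "i \<in> plant_rows s" "x \<in> P" for i x
      using that by (auto simp: plant_rows_def split: prod.splits)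
    show "ext (?row x') (?col x) = 0"
      if "x \<in> P" "x' \<in> P" "x \<noteq> x'" "(case x of (k, \<delta>, c) \<Rightarrow> \<delta>) \<le> (case x' of (k, \<delta>, c) \<Rightarrow> \<delta>)" for x x'
    proof -
      obtain k \<delta> c where "x = (k, \<delta>, c)" by (cases x)
      with that show ?thesis by (cases \<delta>) (auto simp: P_def hi_def split: if_splits)
    qed
  qed
  with card show ?thesis by simp
qed

section \<open>From rank counts to the graph condition\<close>

lemma fixed_spectrum_ext_iff:
  "lam \<in> fixed_spectrum (A_hat A m dm nn) (B_hat n B m dm nn) (C_hat n C m N dm nn) m \<longleftrightarrow>
    n + Nz m dm nn > 0 \<and> (\<exists>s\<subseteq>{0..<m}. rank_le (ext_rows s) (ext_cols s) ext (n + Nz m dm nn - 1))"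
proof -
  have "lam \<in> fixed_spectrum (A_hat A m dm nn) (B_hat n B m dm nn) (C_hat n C m N dm nn) m \<longleftrightarrow>
    n + Nz m dm nn > 0 \<and> (\<exists>s\<subseteq>{0..<m}. pencil_rank_le m (n + Nz m dm nn) (\<lambda>i. p i + nn i)
      (\<lambda>i. dim_row (C_hat n C m N dm nn i)) lam
      (A_hat A m dm nn) (B_hat n B m dm nn) (C_hat n C m N dm nn) s (n + Nz m dm nn - 1))"
  proof (rule fixed_spectrum_iff)
    show "A_hat A m dm nn \<in> carrier_mat (n + Nz m dm nn) (n + Nz m dm nn)" by (rule A_hat_carrier[OF A])
    show "\<forall>i<m. B_hat n B m dm nn i \<in> carrier_mat (n + Nz m dm nn) (p i + nn i)"
      using B B_hat_carrier by blast
    show "\<forall>i<m. C_hat n C m N dm nn i \<in> carrier_mat (dim_row (C_hat n C m N dm nn i)) (n + Nz m dm nn)"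
      using C C_hat_rows(1) finite_N by (metis carrier_matI)
  qed
  then show ?thesis by (simp add: ext_rank_le_iff cong: conj_cong)
qed

text \<open>Off the spectrum the corner \<open>lam - A\<close> alone has rank \<open>n\<close>. This
  settles the values of \<open>lam\<close> on which the assumption about \<open>nn\<close> is
  silent.\<close>

lemma not_eigenvalue_rank:
  assumes "lam \<notin> spec A" "n > 0"
  shows "\<not> rank_le (plant_rows s) (plant_cols s) ext (n - 1)"
proof
  assume "rank_le (plant_rows s) (plant_cols s) ext (n - 1)"
  then have "rank_le {..<n} {..<n} (\<lambda>a b. lam * of_bool (a = b) - of_real (A $$ (a, b))) (n - 1)"
    by (rule rank_le_rel[where R = "\<lambda>a x. x = PlantSt a" and S = "\<lambda>a x. x = PlantSt a"])
      (auto simp: plant_rows_def plant_cols_def)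
  with assms eigenvalue_iff_rank_le[OF A] show False by (auto simp: spec_def)
qed

lemma fixed_spectrum_ext_iff_graph:
  assumes nn: "\<forall>i<m. \<forall>s \<subseteq> {0..<m}. lam \<in> spec A \<longrightarrow> int (nn i) \<ge> int n - int (rank_test n A B C m s lam)"
  shows "lam \<in> fixed_spectrum (A_hat A m dm nn) (B_hat n B m dm nn) (C_hat n C m N dm nn) m \<longleftrightarrow>
    (\<exists>s\<subseteq>{0..<m}. lam \<in> spec A \<and> rank_test n A B C m s lam < n \<and> N_set N ({0..<m} - s) \<inter> s = {})"
  unfolding fixed_spectrum_ext_iff
proof
  assume "\<exists>s\<subseteq>{0..<m}. lam \<in> spec A \<and> rank_test n A B C m s lam < n \<and> N_set N ({0..<m} - s) \<inter> s = {}"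
  then obtain s where s: "s \<subseteq> {0..<m}" "rank_test n A B C m s lam < n" "N_set N ({0..<m} - s) \<inter> s = {}" by blast
  then have "pencil_rank_le m n p q lam A B C s (n - 1)"
    using rank_test_le_iff[OF A B C s(1), of lam "n - 1"] by auto
  then have "rank_le (ext_rows s) (ext_cols s) ext (n - 1 + Nz m dm nn)"
    by (intro ext_rank_upper s) (simp add: plant_rank_le_iff)
  \<comment> \<open>The strict inequality in the rank test forces \<open>n > 0\<close>, so the
    truncated subtractions agree.\<close>
  moreover have "n - 1 + Nz m dm nn = n + Nz m dm nn - 1" using s(2) by simp
  ultimately show "n + Nz m dm nn > 0 \<and> (\<exists>s\<subseteq>{0..<m}. rank_le (ext_rows s) (ext_cols s) ext (n + Nz m dm nn - 1))"
    using s by auto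
next
  assume h: "n + Nz m dm nn > 0 \<and> (\<exists>s\<subseteq>{0..<m}. rank_le (ext_rows s) (ext_cols s) ext (n + Nz m dm nn - 1))"
  have pos: "n + Nz m dm nn > 0" by (rule conjunct1[OF h])
  obtain s where s: "s \<subseteq> {0..<m}"
    and r: "rank_le (ext_rows s) (ext_cols s) ext (n + Nz m dm nn - 1)"
    using conjunct2[OF h] by (elim exE conjE)
  let ?D = "s \<inter> N_set N ({0..<m} - s)"
  define e where "e = (\<Sum>k\<in>?D. nn k)"
  have e: "Nz m dm nn + e \<le> n + Nz m dm nn - 1"
    and pr: "rank_le (plant_rows s) (plant_cols s) ext (n + Nz m dm nn - 1 - (Nz m dm nn + e))"
    using ext_rank_lower[OF s r] by (auto simp: e_def)
  \<comment> \<open>The bound \<open>e < n\<close> makes the subtraction \<open>n - 1 - e\<close>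
    exact, so the plant bound keeps its full strength.\<close>
  have n: "n > 0" "e < n" using e pos by auto
  have "n + Nz m dm nn - 1 - (Nz m dm nn + e) = n - 1 - e" using n by simp
  with pr have pr': "rank_le (plant_rows s) (plant_cols s) ext (n - 1 - e)" by simp
  then have "rank_le (plant_rows s) (plant_cols s) ext (n - 1)" by (rule rank_le_mono) simp
  then have lam: "lam \<in> spec A" using not_eigenvalue_rank n by blast
  have rt: "rank_test n A B C m s lam \<le> n - 1 - e"
    using rank_test_le_iff[OF A B C s, of lam "n - 1 - e"] pr' by (simp add: plant_rank_le_iff)
  \<comment> \<open>A single \<open>k\<close> in \<open>?D\<close> gives
    \<open>e \<ge> nn k\<close>, hence \<open>e\<close> is at least \<open>n\<close> minus the
    tested rank, while that rank is at most \<open>n - 1 - e\<close>.\<close>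
  have "?D = {}"
  proof (rule ccontr)
    assume "?D \<noteq> {}"
    then obtain k where k: "k \<in> ?D" by blast
    have "finite ?D" using s finite_subset by blast
    then have "nn k \<le> e" unfolding e_def using k by (intro member_le_sum) auto
    moreover have "k < m" using k s by auto
    then have "int (nn k) \<ge> int n - int (rank_test n A B C m s lam)" using nn s lam by blast
    ultimately show False using rt n by linarith
  qed
  then show "\<exists>s\<subseteq>{0..<m}. lam \<in> spec A \<and> rank_test n A B C m s lam < n \<and> N_set N ({0..<m} - s) \<inter> s = {}"
    using s lam rt n by (intro exI[of _ s]) auto
qed

end

theorem theorem5:
  fixes n m :: nat
    and A :: "real mat" and B C :: "nat \<Rightarrow> real mat"
    and p q :: "nat \<Rightarrow> nat"
    and N :: "nat \<Rightarrow> nat set"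
    and d :: "nat \<Rightarrow> nat \<Rightarrow> nat"
    and nn :: "nat \<Rightarrow> nat"
  assumes "m \<ge> 1"
    and A: "A \<in> carrier_mat n n"
    and B: "\<forall>i<m. B i \<in> carrier_mat n (p i)"
    and C: "\<forall>i<m. C i \<in> carrier_mat (q i) n"
    and jc: "controllable n A (B_sub n B {0..<m})"
    and jo: "observable n (C_sub n C {0..<m}) A"
    and N: "\<forall>i<m. i \<in> N i \<and> N i \<subseteq> {0..<m}"
    and wc: "weakly_connected m N"
    and dself: "\<forall>i<m. d i i = 0"
    and nn: "\<forall>i<m. \<forall>s \<subseteq> {0..<m}. \<forall>lam \<in> spec A.
               int (nn i) \<ge> int n - int (rank_test n A B C m s lam)"
  shows "fixed_spectrum (A_hat A m (dmax m N d) nn)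
            (B_hat n B m (dmax m N d) nn) (C_hat n C m N (dmax m N d) nn) m = {}
    \<longleftrightarrow> (\<forall>s \<subseteq> {0..<m}. (\<exists>lam \<in> spec A. rank_test n A B C m s lam < n)
            \<longrightarrow> N_set N ({0..<m} - s) \<inter> s \<noteq> {})"
proof -
  have "lam \<in> fixed_spectrum (A_hat A m (dmax m N d) nn)
            (B_hat n B m (dmax m N d) nn) (C_hat n C m N (dmax m N d) nn) m \<longleftrightarrow>
    (\<exists>s\<subseteq>{0..<m}. lam \<in> spec A \<and> rank_test n A B C m s lam < n \<and> N_set N ({0..<m} - s) \<inter> s = {})" for lam
  proof -
    \<comment> \<open>The locale fixes \<open>lam\<close>, so it is interpreted separately for each
      value.\<close>
    interpret extended_system n m A B C p q N "dmax m N d" nn lam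
      by unfold_locales fact+
    show ?thesis by (rule fixed_spectrum_ext_iff_graph) (use nn in blast)
  qed
  then show ?thesis by blast
qed

end
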